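(* Let $\tau > \sqrt{3}$ and let $\rho_{\min}$ be a minimizing measure of the causal variational principle on the sphere $S^2$ with parameter $\tau$. Then the support of $\rho_{\min}$ is contained in a finite number of real analytic curves in $S^2$ which intersect at a finite number of points.
   Context: Let $S^2 \subset \mathbb{R}^3$ be the unit sphere and $\langle x,y\rangle$ the Euclidean scalar product of $x,y \in S^2$. For a parameter $\tau \in [1,\infty)$ define $\mathcal{D}(x,y) = \frac14 (1+\langle x,y\rangle)\,\big(2-\tau^2(1-\langle x,y\rangle)\big)$ and the Lagrangian $\mathcal{L}(x,y) = \max(0,\mathcal{D}(x,y))$ for $x,y\in S^2$. The causal variational principle on the sphere is to minimize the action $\mathcal{S}(\rho)=\int_{S^2} d\rho(x)\int_{S^2} d\rho(y)\,\mathcal{L}(x,y)$ within the class of normalized (i.e. $\rho(S^2)=1$) regular Borel measures on $S^2$. A minimizing measure is a minimizer $\rho_{\min}$ in this class. *)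

theory Defs
  imports "HOL-Probability.Probability"
begin

abbreviation S2 :: "(real ^ 3) set" where
  "S2 \<equiv> sphere 0 1"

definition causal_D :: "real \<Rightarrow> real ^ 3 \<Rightarrow> real ^ 3 \<Rightarrow> real" where
  "causal_D \<tau> x y = 1 / 4 * (1 + x \<bullet> y) * (2 - \<tau>\<^sup>2 * (1 - x \<bullet> y))"

definition lagrangian :: "real \<Rightarrow> real ^ 3 \<Rightarrow> real ^ 3 \<Rightarrow> real" where
  "lagrangian \<tau> x y = max 0 (causal_D \<tau> x y)"

text \<open>The Lagrangian is bounded and continuous on the sphere, so for the finite Borel measures
  considered here no convergence issue is hidden in the Bochner integrals.\<close>

definition causal_action :: "real \<Rightarrow> (real ^ 3) measure \<Rightarrow> real" where
  "causal_action \<tau> \<rho> = (\<integral>x. (\<integral>y. lagrangian \<tau> x y \<partial>\<rho>) \<partial>\<rho>)"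

text \<open>The measures live on the sphere itself: their underlying space is \<open>S2\<close>, with the Borel
  sigma-algebra of the subspace topology.\<close>

definition regular_borel_on :: "'a::topological_space set \<Rightarrow> 'a measure \<Rightarrow> bool" where
  "regular_borel_on X \<mu> \<longleftrightarrow>
     space \<mu> = X \<and> sets \<mu> = sets (restrict_space borel X) \<and>
     (\<forall>B \<in> sets \<mu>.
        emeasure \<mu> B = (SUP K \<in> {K. compact K \<and> K \<subseteq> B}. emeasure \<mu> K) \<and>
        emeasure \<mu> B = (INF U \<in> {U. openin (top_of_set X) U \<and> B \<subseteq> U}. emeasure \<mu> U))"

definition admissible_measures :: "(real ^ 3) measure set" where
  "admissible_measures = {\<rho>. regular_borel_on S2 \<rho> \<and> emeasure \<rho> S2 = 1}"

definition minimizing_measure :: "real \<Rightarrow> (real ^ 3) measure \<Rightarrow> bool" where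
  "minimizing_measure \<tau> \<rho> \<longleftrightarrow>
     \<rho> \<in> admissible_measures \<and>
     (\<forall>\<mu> \<in> admissible_measures. causal_action \<tau> \<rho> \<le> causal_action \<tau> \<mu>)"

definition measure_support :: "'a::topological_space measure \<Rightarrow> 'a set" where
  "measure_support \<mu> =
     {x \<in> space \<mu>. \<forall>U. openin (top_of_set (space \<mu>)) U \<and> x \<in> U \<longrightarrow> emeasure \<mu> U > 0}"

text \<open>As for the library's \<open>analytic_on\<close> over the complex numbers, analyticity at the points of
  \<open>T\<close> refers to full neighbourhoods of these points, also when \<open>T\<close> is not open.\<close>

definition real_analytic_on :: "(real \<Rightarrow> 'a::real_normed_vector) \<Rightarrow> real set \<Rightarrow> bool" where
  "real_analytic_on f T \<longleftrightarrow>
     (\<forall>t \<in> T. \<exists>a r. r > 0 \<and> (\<forall>s. \<bar>s - t\<bar> < r \<longrightarrow> (\<lambda>n. (s - t) ^ n *\<^sub>R a n) sums f s))"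

text \<open>A real analytic curve is the trace of a non-constant map that is analytic on a compact
  interval, end points included. Compactness excludes curves that wind around infinitely often
  (such as spirals or dense curves). Zeros of the velocity are isolated and are allowed: they
  occur at the cusps of analytic sets, as for \<open>t \<mapsto> (t\<^sup>2, t\<^sup>3)\<close>.\<close>

definition real_analytic_curve_in :: "'a::real_normed_vector set \<Rightarrow> 'a set \<Rightarrow> bool" where
  "real_analytic_curve_in X C \<longleftrightarrow>
     (\<exists>\<gamma> a b. a < b \<and> real_analytic_on \<gamma> {a..b} \<and> \<not> \<gamma> constant_on {a..b} \<and>
        C = \<gamma> ` {a..b} \<and> C \<subseteq> X)"

end

theory Submission
  imports Defs "HOL-Complex_Analysis.Complex_Analysis"
begin

text \<open>
  If \<open>\<rho>\<close> is a minimizing measure, second variations show that the kernel \<open>\<L>\<close> is positive semidefinite on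
  bounded densities with respect to \<open>\<rho>\<close> (\<open>minimizer_kernel_positive\<close>). Within a ball of radius \<open>1 / \<tau>\<close> the
  cut-off in \<open>\<L>\<close> is inactive, so that there \<open>\<L> = \<D>\<close> (\<open>lagrangian_eq_causal_D\<close>), and \<open>\<D>(x, y)\<close> is a
  polynomial of degree two in \<open>y\<close>, hence a linear function of the Veronese vector \<open>(y, y y\<^sup>T)\<close>. The mean
  of \<open>\<D>(x, \<cdot>)\<close> over the whole sphere is \<open>(1 - \<tau>\<^sup>2 / 3) / 2\<close>, which is negative for \<open>\<tau> > \<surd>3\<close>. If some
  density in the ball had the same moments of order at most two as the uniform measure of the sphere, it
  would therefore have negative energy. So there is no such density, which means that a hyperplane contains
  the Veronese vectors of the support in the ball: on the ball, the support lies in a quadric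
  \<open>b \<cdot> y + y \<cdot> A y = 0\<close>, and moreover \<open>trace A \<noteq> 0\<close>, so that the quadric does not contain the sphere.
  By compactness, finitely many quadrics suffice (\<open>support_in_finitely_many_quadrics\<close>).

  It remains to cover the intersection \<open>V\<close> of the sphere with one such quadric by analytic arcs. Project
  stereographically from a point \<open>p\<close> of \<open>V\<close>, with the \<open>v\<close>-axis orthogonal to the gradient of the quadratic
  function at \<open>p\<close>. The terms of order three and four in \<open>v\<close> then vanish, and \<open>V\<close> becomes a plane curve
  \<open>A(u) v\<^sup>2 + B(u) v + C(u) = 0\<close>, which the quadratic formula solves. The square root of the discriminant may
  branch and the solutions may tend to infinity, but after the substitution \<open>u = u\<^sub>0 \<plusminus> s\<^sup>2\<close> or
  \<open>u = \<plusminus> 1 / s\<^sup>2\<close> they are meromorphic in \<open>s\<close> near \<open>0\<close>. Back on the sphere the coordinates are bounded and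
  so they extend holomorphically to \<open>s = 0\<close>; this gives an analytic arc with its end point included
  (\<open>stereo_arc_covered\<close>, \<open>side_covered\<close>). A bisection argument glues the one-sided pieces
  (\<open>covered_curve\<close>); arcs over disjoint sets of \<open>u\<close> meet in finitely many points only.

  Curves for different quadrics may share arcs. By the identity theorem an analytic arc either lies in a
  quadric or meets it finitely often (\<open>arc_rigid_quadric\<close>). An arc that has infinitely many points in the
  part covered so far is hence contained in it and may be dropped (\<open>curvilinear_Un\<close>). The finitely many
  points that the arcs omit are put on great circles, which are chosen first.
\<close>

section \<open>Second variations of a minimizing measure\<close>

text \<open>Regularity is automatic for finite measures on a Borel set \<open>X\<close> of a Polish space: push the measure
  forward to the whole space, where inner and outer regularity are classical. So the competitors constructed below, which are
  densities, are admissible as soon as they have total mass one.\<close>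

lemma regular_borel_on_finite:
  fixes X :: "'a::{second_countable_topology, complete_space} set"
  assumes X: "X \<in> sets borel" and sp: "space \<mu> = X" and se: "sets \<mu> = sets (restrict_space borel X)"
    and fin: "emeasure \<mu> X \<noteq> \<infinity>"
  shows "regular_borel_on X \<mu>"
proof -
  define \<nu> where "\<nu> = distr \<mu> borel id"
  have idm: "id \<in> measurable \<mu> borel"
    using se by (metis measurable_cong_sets measurable_id measurable_restrict_space1 id_def measurable_ident)
  have nu: "emeasure \<nu> B = emeasure \<mu> (B \<inter> X)" if "B \<in> sets borel" for B
    unfolding \<nu>_def using that idm sp by (simp add: emeasure_distr)
  have nus: "sets \<nu> = sets borel" unfolding \<nu>_def by simp
  have nuf: "emeasure \<nu> (space \<nu>) \<noteq> \<infinity>"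
    using nu[of UNIV] fin by (simp add: \<nu>_def)
  have main: "emeasure \<mu> B = (SUP K \<in> {K. compact K \<and> K \<subseteq> B}. emeasure \<mu> K) \<and>
        emeasure \<mu> B = (INF U \<in> {U. openin (top_of_set X) U \<and> B \<subseteq> U}. emeasure \<mu> U)"
    if "B \<in> sets \<mu>" for B
  proof -
    have B: "B \<in> sets borel" "B \<subseteq> X"
      using that se X by (auto simp: sets_restrict_space_iff)
    have "B \<inter> X = B" using B by auto
    with nu B have eB: "emeasure \<mu> B = emeasure \<nu> B" by simp
    have K: "emeasure \<mu> K = emeasure \<nu> K" if "compact K" "K \<subseteq> B" for K
    proof -
      have "K \<inter> X = K" using that B by auto
      then show ?thesis using nu[of K] that by (simp add: borel_compact)
    qed
    have "emeasure \<nu> B = (SUP K \<in> {K. K \<subseteq> B \<and> compact K}. emeasure \<nu> K)"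
      by (rule inner_regular[OF nus nuf B(1)])
    also have "\<dots> = (SUP K \<in> {K. compact K \<and> K \<subseteq> B}. emeasure \<mu> K)"
      by (rule SUP_cong) (auto simp: K)
    finally have 1: "emeasure \<nu> B = (SUP K \<in> {K. compact K \<and> K \<subseteq> B}. emeasure \<mu> K)" .
    have "emeasure \<nu> B = (INF U \<in> {U. B \<subseteq> U \<and> open U}. emeasure \<nu> U)"
      by (rule outer_regular[OF nus nuf B(1)])
    also have "\<dots> = (INF U \<in> {U. B \<subseteq> U \<and> open U}. emeasure \<mu> (U \<inter> X))"
      by (rule INF_cong) (auto simp: nu)
    also have "\<dots> = (INF U \<in> (\<lambda>U. U \<inter> X) ` {U. B \<subseteq> U \<and> open U}. emeasure \<mu> U)"
      by (simp add: image_comp)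
    also have "(\<lambda>U. U \<inter> X) ` {U. B \<subseteq> U \<and> open U} = {U. openin (top_of_set X) U \<and> B \<subseteq> U}"
      using B(2) by (auto simp: openin_open)
    finally have 2: "emeasure \<nu> B = (INF U \<in> {U. openin (top_of_set X) U \<and> B \<subseteq> U}. emeasure \<mu> U)" .
    show ?thesis using 1 2 eB by simp
  qed
  then show ?thesis unfolding regular_borel_on_def using sp se by blast
qed

lemma S2_borel: "S2 \<in> sets borel"
  by (simp add: borel_compact)

lemma admissible_iff:
  "\<rho> \<in> admissible_measures \<longleftrightarrow>
     space \<rho> = S2 \<and> sets \<rho> = sets (restrict_space borel S2) \<and> prob_space \<rho>"
proof
  assume "\<rho> \<in> admissible_measures"
  then show "space \<rho> = S2 \<and> sets \<rho> = sets (restrict_space borel S2) \<and> prob_space \<rho>"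
    by (auto simp: admissible_measures_def regular_borel_on_def intro!: prob_spaceI)
next
  assume *: "space \<rho> = S2 \<and> sets \<rho> = sets (restrict_space borel S2) \<and> prob_space \<rho>"
  then have "emeasure \<rho> S2 = 1" using prob_space.emeasure_space_1 by metis
  with * show "\<rho> \<in> admissible_measures"
    by (auto simp: admissible_measures_def intro!: regular_borel_on_finite[OF S2_borel])
qed

lemma borel_measurable_admissible:
  fixes f :: "real ^ 3 \<Rightarrow> 'a::topological_space"
  assumes "\<rho> \<in> admissible_measures" "f \<in> borel_measurable borel"
  shows "f \<in> borel_measurable \<rho>"
proof -
  have "f \<in> borel_measurable (restrict_space borel S2)"
    using assms(2) by (rule measurable_restrict_space1)
  then show ?thesis using assms(1) by (simp add: admissible_iff cong: measurable_cong_sets)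
qed

lemma integrable_admissible:
  fixes f :: "real ^ 3 \<Rightarrow> 'a::{banach, second_countable_topology}"
  assumes "\<rho> \<in> admissible_measures" "f \<in> borel_measurable \<rho>" "\<And>x. x \<in> S2 \<Longrightarrow> norm (f x) \<le> K"
  shows "integrable \<rho> f"
proof -
  interpret prob_space \<rho> using assms(1) by (simp add: admissible_iff)
  show ?thesis
    using assms by (intro integrable_const_bound[where B=K] AE_I2) (auto simp: admissible_iff)
qed

lemma lagrangian_bound:
  assumes "x \<in> S2" "y \<in> S2"
  shows "0 \<le> lagrangian \<tau> x y" "\<bar>lagrangian \<tau> x y\<bar> \<le> 1 + \<tau>\<^sup>2"
proof -
  have s: "\<bar>x \<bullet> y\<bar> \<le> 1" using Cauchy_Schwarz_ineq2[of x y] assms by simp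
  have "\<bar>1 + x \<bullet> y\<bar> \<le> 2" using s by linarith
  moreover have "\<bar>2 - \<tau>\<^sup>2 * (1 - x \<bullet> y)\<bar> \<le> 2 + \<tau>\<^sup>2 * 2"
  proof -
    have "\<tau>\<^sup>2 * (1 - x \<bullet> y) \<le> \<tau>\<^sup>2 * 2" "0 \<le> \<tau>\<^sup>2 * (1 - x \<bullet> y)"
      using s by (auto intro!: mult_left_mono mult_nonneg_nonneg)
    then show ?thesis by linarith
  qed
  ultimately have "\<bar>1 + x \<bullet> y\<bar> * \<bar>2 - \<tau>\<^sup>2 * (1 - x \<bullet> y)\<bar> \<le> 2 * (2 + \<tau>\<^sup>2 * 2)"
    by (intro mult_mono) auto
  then have "\<bar>causal_D \<tau> x y\<bar> \<le> 1 + \<tau>\<^sup>2"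
    unfolding causal_D_def abs_mult by simp
  then show "0 \<le> lagrangian \<tau> x y" "\<bar>lagrangian \<tau> x y\<bar> \<le> 1 + \<tau>\<^sup>2"
    unfolding lagrangian_def by auto
qed

definition potential :: "real \<Rightarrow> (real ^ 3) measure \<Rightarrow> (real ^ 3 \<Rightarrow> real) \<Rightarrow> real ^ 3 \<Rightarrow> real" where
  "potential \<tau> \<rho> f x = (\<integral>y. f y * lagrangian \<tau> x y \<partial>\<rho>)"

lemma lagrangian_measurable:
  assumes "\<rho> \<in> admissible_measures"
  shows "lagrangian \<tau> x \<in> borel_measurable \<rho>"
  by (rule borel_measurable_admissible[OF assms]) (unfold lagrangian_def causal_D_def, measurable)

lemma potential_measurable:
  assumes "\<rho> \<in> admissible_measures" "f \<in> borel_measurable \<rho>"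
  shows "potential \<tau> \<rho> f \<in> borel_measurable \<rho>"
proof -
  interpret prob_space \<rho> using assms(1) by (simp add: admissible_iff)
  have id: "(\<lambda>x. x) \<in> borel_measurable \<rho>"
    by (rule borel_measurable_admissible[OF assms(1)]) simp
  have fst: "fst \<in> borel_measurable (\<rho> \<Otimes>\<^sub>M \<rho>)" and snd: "snd \<in> borel_measurable (\<rho> \<Otimes>\<^sub>M \<rho>)"
    using measurable_comp[OF measurable_fst id] measurable_comp[OF measurable_snd id]
    by (simp_all add: comp_def)
  have "(\<lambda>z. lagrangian \<tau> (fst z) (snd z)) \<in> borel_measurable (\<rho> \<Otimes>\<^sub>M \<rho>)"
    unfolding lagrangian_def causal_D_def using fst snd by measurable
  moreover have "(\<lambda>z. f (snd z)) \<in> borel_measurable (\<rho> \<Otimes>\<^sub>M \<rho>)"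
    using assms(2) by measurable
  ultimately have "(\<lambda>(x, y). f y * lagrangian \<tau> x y) \<in> borel_measurable (\<rho> \<Otimes>\<^sub>M \<rho>)"
    by (simp add: case_prod_beta)
  then show ?thesis
    unfolding potential_def by (rule borel_measurable_lebesgue_integral)
qed

lemma integrable_lagrangian:
  assumes "\<rho> \<in> admissible_measures" "f \<in> borel_measurable \<rho>" "\<And>x. x \<in> S2 \<Longrightarrow> \<bar>f x\<bar> \<le> K" "x \<in> S2"
  shows "integrable \<rho> (\<lambda>y. f y * lagrangian \<tau> x y)"
proof (rule integrable_admissible[OF assms(1)])
  show "(\<lambda>y. f y * lagrangian \<tau> x y) \<in> borel_measurable \<rho>"
    using assms(2) lagrangian_measurable[OF assms(1)] by measurable
  show "norm (f y * lagrangian \<tau> x y) \<le> K * (1 + \<tau>\<^sup>2)" if "y \<in> S2" for y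
  proof -
    have "\<bar>f y\<bar> * \<bar>lagrangian \<tau> x y\<bar> \<le> K * (1 + \<tau>\<^sup>2)"
      using assms(3)[OF that] lagrangian_bound(2)[OF assms(4) that] by (intro mult_mono) auto
    then show ?thesis by (simp add: abs_mult)
  qed
qed

lemma potential_bound:
  assumes "\<rho> \<in> admissible_measures" "f \<in> borel_measurable \<rho>" "\<And>x. x \<in> S2 \<Longrightarrow> \<bar>f x\<bar> \<le> K" "x \<in> S2"
  shows "\<bar>potential \<tau> \<rho> f x\<bar> \<le> K * (1 + \<tau>\<^sup>2)"
proof -
  interpret prob_space \<rho> using assms(1) by (simp add: admissible_iff)
  have "\<bar>\<integral>y. f y * lagrangian \<tau> x y \<partial>\<rho>\<bar> \<le> (\<integral>y. K * (1 + \<tau>\<^sup>2) \<partial>\<rho>)"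
  proof (rule integral_abs_bound[THEN order_trans], rule integral_mono)
    show "integrable \<rho> (\<lambda>y. \<bar>f y * lagrangian \<tau> x y\<bar>)"
      using integrable_lagrangian[OF assms] by (rule integrable_abs)
    fix y assume "y \<in> space \<rho>"
    then have "y \<in> S2" using assms(1) by (simp add: admissible_iff)
    then have "\<bar>f y\<bar> * \<bar>lagrangian \<tau> x y\<bar> \<le> K * (1 + \<tau>\<^sup>2)"
      using assms(3) lagrangian_bound(2)[OF assms(4)] by (intro mult_mono) (auto intro: order_trans[OF abs_ge_zero])
    then show "\<bar>f y * lagrangian \<tau> x y\<bar> \<le> K * (1 + \<tau>\<^sup>2)" by (simp add: abs_mult)
  qed auto
  then show ?thesis unfolding potential_def by (simp add: prob_space)
qed

lemma density_admissible:
  assumes "\<rho> \<in> admissible_measures" "h \<in> borel_measurable \<rho>" "\<And>x. x \<in> S2 \<Longrightarrow> 0 \<le> h x"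
    "integrable \<rho> h" "(\<integral>x. h x \<partial>\<rho>) = 1"
  shows "density \<rho> (\<lambda>x. ennreal (h x)) \<in> admissible_measures"
proof -
  have sp: "space \<rho> = S2" using assms(1) by (simp add: admissible_iff)
  have "(\<integral>\<^sup>+ x. ennreal (h x) \<partial>\<rho>) = ennreal (\<integral>x. h x \<partial>\<rho>)"
    using assms(3) sp by (intro nn_integral_eq_integral[OF assms(4)] AE_I2) auto
  then have "emeasure (density \<rho> (\<lambda>x. ennreal (h x))) (space \<rho>) = 1"
    using assms(2,5) by (simp add: emeasure_density cong: nn_integral_cong)
  then have "prob_space (density \<rho> (\<lambda>x. ennreal (h x)))"
    by (intro prob_spaceI) simp
  then show ?thesis using assms(1) by (simp add: admissible_iff)
qed

lemma action_density:
  assumes "\<rho> \<in> admissible_measures" "h \<in> borel_measurable \<rho>" "\<And>x. x \<in> S2 \<Longrightarrow> 0 \<le> h x"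
  shows "causal_action \<tau> (density \<rho> (\<lambda>x. ennreal (h x))) = (\<integral>x. h x * potential \<tau> \<rho> h x \<partial>\<rho>)"
proof -
  have ae: "AE x in \<rho>. 0 \<le> h x" using assms(1,3) by (intro AE_I2) (simp add: admissible_iff)
  have 1: "(\<integral>y. lagrangian \<tau> x y \<partial>density \<rho> (\<lambda>x. ennreal (h x))) = potential \<tau> \<rho> h x" for x
    unfolding potential_def
    using integral_density[OF lagrangian_measurable[OF assms(1)] assms(2) ae, of \<tau> x] by simp
  show ?thesis
    unfolding causal_action_def 1
    using integral_density[OF potential_measurable[OF assms(1,2)] assms(2) ae, of \<tau>] by simp
qed

lemma quadratic_nonneg_near_zero:
  fixes \<alpha> \<beta> \<delta> :: real
  assumes "\<delta> > 0" "\<And>t. \<bar>t\<bar> \<le> \<delta> \<Longrightarrow> 0 \<le> t * \<alpha> + t\<^sup>2 * \<beta>"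
  shows "\<alpha> = 0" "\<beta> \<ge> 0"
proof -
  show a: "\<alpha> = 0"
  proof (rule ccontr)
    assume "\<alpha> \<noteq> 0"
    define t where "t = min \<delta> (\<bar>\<alpha>\<bar> / (2 * (\<bar>\<beta>\<bar> + 1)))"
    have t: "t > 0" "t \<le> \<delta>" using \<open>\<alpha> \<noteq> 0\<close> assms(1) by (auto simp: t_def)
    have "t * (2 * (\<bar>\<beta>\<bar> + 1)) \<le> \<bar>\<alpha>\<bar>"
      using pos_le_divide_eq[of "2 * (\<bar>\<beta>\<bar> + 1)" t "\<bar>\<alpha>\<bar>"] by (simp add: t_def)
    moreover have "t * (2 * (\<bar>\<beta>\<bar> + 1)) = 2 * (t * \<bar>\<beta>\<bar>) + 2 * t" by (simp add: algebra_simps)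
    moreover have "0 \<le> t * \<bar>\<beta>\<bar>" using t(1) by simp
    ultimately have tb: "t * \<bar>\<beta>\<bar> < \<bar>\<alpha>\<bar>" using t(1) by linarith
    have "0 \<le> (- sgn \<alpha> * t) * \<alpha> + (- sgn \<alpha> * t)\<^sup>2 * \<beta>"
      using t by (intro assms(2)) (simp add: abs_mult abs_sgn_eq)
    also have "\<dots> = t * (t * \<beta> - \<bar>\<alpha>\<bar>)"
      using \<open>\<alpha> \<noteq> 0\<close> by (cases "\<alpha> > 0") (auto simp: sgn_if power2_eq_square algebra_simps)
    finally have "0 \<le> t * \<beta> - \<bar>\<alpha>\<bar>" using t(1) by (simp add: zero_le_mult_iff)
    moreover have "t * \<beta> \<le> t * \<bar>\<beta>\<bar>" using t(1) by (simp add: mult_left_mono)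
    ultimately show False using tb by linarith
  qed
  have "0 \<le> \<delta> * \<alpha> + \<delta>\<^sup>2 * \<beta>" using assms by (intro assms(2)) auto
  then show "\<beta> \<ge> 0" using a assms(1) by (simp add: zero_le_mult_iff)
qed

text \<open>The competitors \<open>(1 + t (f - m)) \<rho>\<close> with \<open>m = \<integral>f d\<rho>\<close> are positive for small \<open>t\<close> of either sign. Their
  action is quadratic in \<open>t\<close> and minimal at \<open>t = 0\<close>, so the linear term vanishes and the quadratic one is
  nonnegative. With the former, the latter says that the energy of \<open>f\<close> is at least \<open>m\<^sup>2\<close> times the minimal
  action.\<close>

lemma minimizer_kernel_positive:
  assumes min: "minimizing_measure \<tau> \<rho>" and f: "f \<in> borel_measurable \<rho>"
    and K: "\<And>x. x \<in> S2 \<Longrightarrow> \<bar>f x\<bar> \<le> K"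
  shows "0 \<le> (\<integral>x. f x * potential \<tau> \<rho> f x \<partial>\<rho>)"
proof -
  have adm: "\<rho> \<in> admissible_measures" using min by (simp add: minimizing_measure_def)
  interpret prob_space \<rho> using adm by (simp add: admissible_iff)
  have sp: "space \<rho> = S2" using adm by (simp add: admissible_iff)
  let ?P = "potential \<tau> \<rho>"
  have intb: "integrable \<rho> g" if "g \<in> borel_measurable \<rho>" "\<And>x. x \<in> S2 \<Longrightarrow> \<bar>g x\<bar> \<le> k" for g :: "_ \<Rightarrow> real" and k
    using that by (intro integrable_admissible[OF adm]) auto
  have one: "(\<lambda>x. 1::real) \<in> borel_measurable \<rho>" by simp
  have if1: "integrable \<rho> f" by (rule intb[OF f K])
  define m where "m = (\<integral>x. f x \<partial>\<rho>)"
  define \<Lambda> where "\<Lambda> = 1 + \<tau>\<^sup>2"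
  have P1m: "?P (\<lambda>x. 1) \<in> borel_measurable \<rho>" and Pfm: "?P f \<in> borel_measurable \<rho>"
    using potential_measurable[OF adm] f by auto
  have P1b: "\<bar>?P (\<lambda>x. 1) x\<bar> \<le> 1 * \<Lambda>" if "x \<in> S2" for x
    unfolding \<Lambda>_def by (rule potential_bound[OF adm one _ that]) simp
  have Pfb: "\<bar>?P f x\<bar> \<le> K * \<Lambda>" if "x \<in> S2" for x
    unfolding \<Lambda>_def by (rule potential_bound[OF adm f K that])
  have iP1: "integrable \<rho> (?P (\<lambda>x. 1))" by (rule intb[OF P1m P1b])
  have iPf: "integrable \<rho> (?P f)" by (rule intb[OF Pfm Pfb])
  have ifP1: "integrable \<rho> (\<lambda>x. f x * ?P (\<lambda>x. 1) x)"
  proof (rule intb)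
    show "\<bar>f x * ?P (\<lambda>x. 1) x\<bar> \<le> K * (1 * \<Lambda>)" if "x \<in> S2" for x
      unfolding abs_mult using K[OF that] P1b[OF that] by (intro mult_mono) auto
  qed (use f P1m in measurable)
  have ifPf: "integrable \<rho> (\<lambda>x. f x * ?P f x)"
  proof (rule intb)
    show "\<bar>f x * ?P f x\<bar> \<le> K * (K * \<Lambda>)" if "x \<in> S2" for x
      unfolding abs_mult using K[OF that] Pfb[OF that] by (intro mult_mono) auto
  qed (use f Pfm in measurable)
  define S0 where "S0 = (\<integral>x. ?P (\<lambda>x. 1) x \<partial>\<rho>)"
  define a where "a = (\<integral>x. ?P f x \<partial>\<rho>)"
  define b where "b = (\<integral>x. f x * ?P (\<lambda>x. 1) x \<partial>\<rho>)"
  define c where "c = (\<integral>x. f x * ?P f x \<partial>\<rho>)"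
  have S: "causal_action \<tau> \<rho> = S0"
    unfolding causal_action_def S0_def potential_def by simp
  have S0: "S0 \<ge> 0"
    unfolding S0_def potential_def
    using lagrangian_bound(1) sp by (intro Bochner_Integration.integral_nonneg) auto
  have ne: "S2 \<noteq> {}" using not_empty sp by simp
  then have K0: "K \<ge> 0" using K by (meson abs_ge_zero all_not_in_conv order_trans)
  \<comment> \<open>the range of \<open>t\<close> for which the competitor is nonnegative, since \<open>\<bar>f - m\<bar> \<le> K + \<bar>m\<bar>\<close>\<close>
  define \<delta> where "\<delta> = 1 / (K + \<bar>m\<bar> + 1)"
  have \<delta>: "\<delta> > 0" using K0 by (simp add: \<delta>_def)
  have key: "0 \<le> t * (a + b - 2 * m * S0) + t\<^sup>2 * (c - m * a - m * b + m\<^sup>2 * S0)" if t: "\<bar>t\<bar> \<le> \<delta>" for t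
  proof -
    define h where "h = (\<lambda>x. (1 - t * m) + t * f x)"
    have hm: "h \<in> borel_measurable \<rho>" unfolding h_def using f by measurable
    have h0: "0 \<le> h x" if x: "x \<in> S2" for x
    proof -
      have "\<bar>f x - m\<bar> \<le> K + \<bar>m\<bar> + 1" using K[OF x] by linarith
      then have "\<bar>t\<bar> * \<bar>f x - m\<bar> \<le> \<delta> * (K + \<bar>m\<bar> + 1)"
        using t \<delta> by (intro mult_mono) auto
      also have "\<dots> = 1" using K0 by (simp add: \<delta>_def)
      finally have "\<bar>t * (f x - m)\<bar> \<le> 1" by (simp add: abs_mult)
      then show ?thesis unfolding h_def by (simp add: algebra_simps)
    qed
    have hi: "integrable \<rho> h" unfolding h_def using if1 by simp
    have h1: "(\<integral>x. h x \<partial>\<rho>) = 1"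
      unfolding h_def using if1 by (simp add: m_def prob_space)
    have Ph: "?P h x = (1 - t * m) * ?P (\<lambda>x. 1) x + t * ?P f x" if x: "x \<in> S2" for x
    proof -
      have i1: "integrable \<rho> (\<lambda>y. 1 * lagrangian \<tau> x y)"
        by (rule integrable_lagrangian[OF adm one _ x, where K=1]) simp
      have i2: "integrable \<rho> (\<lambda>y. f y * lagrangian \<tau> x y)"
        by (rule integrable_lagrangian[OF adm f K x])
      have "?P h x = (\<integral>y. (1 - t * m) * (1 * lagrangian \<tau> x y) + t * (f y * lagrangian \<tau> x y) \<partial>\<rho>)"
        unfolding potential_def h_def by (simp add: algebra_simps)
      also have "\<dots> = (1 - t * m) * ?P (\<lambda>x. 1) x + t * ?P f x"
        unfolding potential_def using i1 i2 by simp
      finally show ?thesis .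
    qed
    have "S0 \<le> (\<integral>x. h x * ?P h x \<partial>\<rho>)"
      using min density_admissible[OF adm hm h0 hi h1] action_density[OF adm hm h0]
      unfolding minimizing_measure_def S[symmetric] by metis
    also have "\<dots> = (\<integral>x. (1 - t * m)\<^sup>2 * ?P (\<lambda>x. 1) x + (1 - t * m) * t * ?P f x
        + (1 - t * m) * t * (f x * ?P (\<lambda>x. 1) x) + t\<^sup>2 * (f x * ?P f x) \<partial>\<rho>)"
    proof (intro Bochner_Integration.integral_cong refl)
      fix x assume "x \<in> space \<rho>"
      then have x: "x \<in> S2" using sp by simp
      show "h x * ?P h x = (1 - t * m)\<^sup>2 * ?P (\<lambda>x. 1) x + (1 - t * m) * t * ?P f x
        + (1 - t * m) * t * (f x * ?P (\<lambda>x. 1) x) + t\<^sup>2 * (f x * ?P f x)"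
        unfolding Ph[OF x] unfolding h_def by algebra
    qed
    also have "\<dots> = (1 - t * m)\<^sup>2 * S0 + (1 - t * m) * t * a + (1 - t * m) * t * b + t\<^sup>2 * c"
      unfolding S0_def a_def b_def c_def using iP1 iPf ifP1 ifPf by simp
    finally show ?thesis by (simp add: power2_eq_square algebra_simps)
  qed
  \<comment> \<open>the Euler--Lagrange identity, integrated against \<open>f\<close>, and the second variation\<close>
  have "a + b = 2 * m * S0" "0 \<le> c - m * a - m * b + m\<^sup>2 * S0"
    using quadratic_nonneg_near_zero[OF \<delta> key] by auto
  then have "0 \<le> c - m * (2 * m * S0) + m\<^sup>2 * S0"
    by (metis diff_diff_eq distrib_left)
  then have "m\<^sup>2 * S0 \<le> c" by (simp add: power2_eq_square algebra_simps)
  moreover have "0 \<le> m\<^sup>2 * S0" using S0 by simp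
  ultimately show ?thesis unfolding c_def by linarith
qed

section \<open>The support lies on finitely many quadrics\<close>

definition quad :: "real ^ 3 \<Rightarrow> real ^ 3 ^ 3 \<Rightarrow> real ^ 3 \<Rightarrow> real" where
  "quad b A x = b \<bullet> x + x \<bullet> (A *v x)"

text \<open>The Veronese map: every polynomial of degree at most two on the sphere is a linear function of it, the
  constants included because \<open>y y\<^sup>T\<close> has trace one there.\<close>

definition veronese :: "real ^ 3 \<Rightarrow> (real ^ 3) \<times> (real ^ 3 ^ 3)" where
  "veronese x = (x, \<chi> i. x $ i *\<^sub>R x)"

text \<open>The mean of the Veronese map with respect to the uniform measure of the sphere.\<close>

definition sphere_mean :: "(real ^ 3) \<times> (real ^ 3 ^ 3)" where
  "sphere_mean = (0, (1 / 3) *\<^sub>R mat 1)"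

lemma inner_veronese: "(b, A) \<bullet> veronese x = quad b A x"
  by (simp add: quad_def veronese_def inner_prod_def inner_vec_def matrix_vector_mult_def
      sum_3 algebra_simps)

lemma inner_sphere_mean: "(b, A) \<bullet> sphere_mean = trace A / 3"
  by (simp add: sphere_mean_def inner_prod_def inner_vec_def trace_def mat_def sum_3)

lemma continuous_on_veronese: "continuous_on S veronese"
  unfolding veronese_def by (intro continuous_intros continuous_on_vec_lambda)

text \<open>The linear functional on Veronese vectors that represents \<open>\<D>(x, \<cdot>)\<close>. As \<open>\<D>(x, y)\<close> is
  \<open>((2 - \<tau>\<^sup>2) + 2 (x \<cdot> y) + \<tau>\<^sup>2 (x \<cdot> y)\<^sup>2) / 4\<close>, its constant term is carried by the identity matrix.\<close>

definition kernel_covector :: "real \<Rightarrow> real ^ 3 \<Rightarrow> (real ^ 3) \<times> (real ^ 3 ^ 3)" where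
  "kernel_covector \<tau> x =
     ((1 / 2) *\<^sub>R x, ((2 - \<tau>\<^sup>2) / 4) *\<^sub>R mat 1 + (\<tau>\<^sup>2 / 4) *\<^sub>R (\<chi> i. x $ i *\<^sub>R x))"

lemma causal_D_veronese:
  assumes "y \<in> S2"
  shows "causal_D \<tau> x y = kernel_covector \<tau> x \<bullet> veronese y"
proof -
  have "y \<bullet> y = 1" using assms by (simp add: dot_square_norm)
  then have y: "y $ 1 * y $ 1 + y $ 2 * y $ 2 + y $ 3 * y $ 3 = 1"
    by (simp add: inner_vec_def sum_3)
  define s where "s = x \<bullet> y"
  have q: "kernel_covector \<tau> x \<bullet> veronese y =
      s / 2 + (2 - \<tau>\<^sup>2) / 4 * (y $ 1 * y $ 1 + y $ 2 * y $ 2 + y $ 3 * y $ 3) + \<tau>\<^sup>2 / 4 * s\<^sup>2"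
    unfolding s_def kernel_covector_def veronese_def
    by (simp add: inner_prod_def inner_vec_def mat_def sum_3 power2_eq_square algebra_simps add_divide_distrib diff_divide_distrib)
  show ?thesis
    unfolding q y causal_D_def s_def[symmetric] by (simp add: field_simps power2_eq_square)
qed

text \<open>The mean of \<open>\<D>(x, \<cdot>)\<close> over the sphere: \<open>(x \<cdot> y)\<^sup>2\<close> has mean \<open>1 / 3\<close>, and this is where \<open>\<surd>3\<close> comes from.\<close>

lemma kernel_covector_mean:
  assumes "x \<in> S2"
  shows "kernel_covector \<tau> x \<bullet> sphere_mean = (1 - \<tau>\<^sup>2 / 3) / 2"
proof -
  have "x \<bullet> x = 1" using assms by (simp add: dot_square_norm)
  then have x: "x $ 1 * x $ 1 + x $ 2 * x $ 2 + x $ 3 * x $ 3 = 1"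
    by (simp add: inner_vec_def sum_3)
  have "kernel_covector \<tau> x \<bullet> sphere_mean =
     (2 - \<tau>\<^sup>2) / 4 + \<tau>\<^sup>2 / 12 * (x $ 1 * x $ 1 + x $ 2 * x $ 2 + x $ 3 * x $ 3)"
    unfolding kernel_covector_def sphere_mean_def
    by (simp add: inner_prod_def inner_vec_def mat_def sum_3 algebra_simps add_divide_distrib diff_divide_distrib)
  then show ?thesis unfolding x by (simp add: field_simps)
qed

text \<open>On the sphere, \<open>\<bar>x - y\<bar>\<^sup>2 = 2 (1 - x \<cdot> y)\<close>, so that the second factor of \<open>\<D>\<close> is nonnegative exactly up to
  the distance \<open>2 / \<tau>\<close>.\<close>

lemma lagrangian_eq_causal_D:
  assumes "\<tau> > 0" "x \<in> S2" "y \<in> S2" "dist x y \<le> 2 / \<tau>"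
  shows "lagrangian \<tau> x y = causal_D \<tau> x y"
proof -
  have s: "\<bar>x \<bullet> y\<bar> \<le> 1" using Cauchy_Schwarz_ineq2[of x y] assms by simp
  have "(dist x y)\<^sup>2 = 2 - 2 * (x \<bullet> y)"
    using assms(2,3) by (simp add: dist_norm power2_norm_eq_inner inner_diff_left inner_diff_right
        inner_commute[of y x] norm_eq_1)
  moreover have "(dist x y)\<^sup>2 \<le> (2 / \<tau>)\<^sup>2" using assms(4) by (intro power_mono) auto
  ultimately have "2 - 2 * (x \<bullet> y) \<le> 4 / \<tau>\<^sup>2" by (simp add: power_divide)
  then have "\<tau>\<^sup>2 * (2 - 2 * (x \<bullet> y)) \<le> 4"
    using assms(1) pos_le_divide_eq[of "\<tau>\<^sup>2" "2 - 2 * (x \<bullet> y)" 4] by (simp add: mult.commute)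
  then have "0 \<le> 2 - \<tau>\<^sup>2 * (1 - x \<bullet> y)" by (simp add: algebra_simps)
  then have "0 \<le> causal_D \<tau> x y" unfolding causal_D_def using s by simp
  then show ?thesis by (simp add: lagrangian_def)
qed

text \<open>The vectors \<open>\<integral>\<^sub>N (w \<cdot> \<Phi>) \<Phi> d\<rho>\<close>, where \<open>\<Phi>\<close> is the Veronese map and \<open>N\<close> the ball, form the range of a
  symmetric operator \<open>G\<close>. If the mean of the sphere were in this range, a density \<open>w \<cdot> \<Phi>\<close> on \<open>N\<close> would have
  the constant negative potential \<open>(1 - \<tau>\<^sup>2 / 3) / 2\<close> there and total mass one, against positivity. So the
  component \<open>z\<close> of the mean orthogonal to the range is not zero. Then \<open>\<integral>\<^sub>N (z \<cdot> \<Phi>)\<^sup>2 d\<rho> = z \<cdot> G z = 0\<close>, and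
  \<open>z \<cdot> \<Phi>\<close> vanishes on the support in \<open>N\<close>. The trace belonging to \<open>z\<close> is \<open>3 z \<cdot> z\<close> because \<open>z\<close> pairs with the
  mean as with itself.\<close>

lemma support_locally_in_quadric:
  assumes \<tau>: "\<tau> > sqrt 3" and min: "minimizing_measure \<tau> \<rho>"
  shows "\<exists>b A. trace A \<noteq> 0 \<and> (\<forall>x \<in> measure_support \<rho> \<inter> ball a (1 / \<tau>). quad b A x = 0)"
proof -
  have \<tau>0: "\<tau> > 0" using \<tau> by (meson less_trans real_sqrt_gt_zero zero_less_numeral)
  have \<tau>2: "\<tau>\<^sup>2 > 3" using power_strict_mono[OF \<tau>, of 2] by simp
  have adm: "\<rho> \<in> admissible_measures" using min by (simp add: minimizing_measure_def)
  interpret prob_space \<rho> using adm by (simp add: admissible_iff)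
  have sp: "space \<rho> = S2" and ss: "sets \<rho> = sets (restrict_space borel S2)"
    using adm by (auto simp: admissible_iff)
  define N where "N = ball a (1 / \<tau>)"
  have "bounded (veronese ` S2)"
    by (intro compact_imp_bounded compact_continuous_image continuous_on_veronese compact_sphere)
  then obtain B where B: "\<And>x. x \<in> S2 \<Longrightarrow> norm (veronese x) \<le> B"
    unfolding bounded_iff by blast
  define f where "f w x = indicator N x * (w \<bullet> veronese x)" for w and x :: "real ^ 3"
  have meas_veronese: "veronese \<in> borel_measurable borel"
    by (rule borel_measurable_continuous_onI[OF continuous_on_veronese])
  have fb: "f w \<in> borel_measurable borel" for w
  proof -
    have "(indicator N :: real ^ 3 \<Rightarrow> real) \<in> borel_measurable borel"
      unfolding N_def by (intro borel_measurable_indicator) simp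
    moreover have "(\<lambda>x. w \<bullet> veronese x) \<in> borel_measurable borel"
      using meas_veronese by (intro borel_measurable_inner) auto
    ultimately show ?thesis unfolding f_def by (rule borel_measurable_times)
  qed
  have fm: "f w \<in> borel_measurable \<rho>" for w
    by (rule borel_measurable_admissible[OF adm fb])
  have fK: "\<bar>f w x\<bar> \<le> norm w * B" if "x \<in> S2" for w x
  proof -
    have "\<bar>w \<bullet> veronese x\<bar> \<le> norm w * norm (veronese x)" by (rule Cauchy_Schwarz_ineq2)
    also have "\<dots> \<le> norm w * B" using B[OF that] by (intro mult_left_mono) auto
    finally have "\<bar>w \<bullet> veronese x\<bar> \<le> norm w * B" .
    then show ?thesis unfolding f_def
      using order_trans[OF abs_ge_zero \<open>\<bar>w \<bullet> veronese x\<bar> \<le> norm w * B\<close>]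
        \<open>\<bar>w \<bullet> veronese x\<bar> \<le> norm w * B\<close> by (simp add: indicator_def)
  qed
  have iG: "integrable \<rho> (\<lambda>x. f w x *\<^sub>R veronese x)" for w
  proof (rule integrable_admissible[OF adm])
    show "(\<lambda>x. f w x *\<^sub>R veronese x) \<in> borel_measurable \<rho>"
      using fm borel_measurable_admissible[OF adm meas_veronese] by measurable
    show "norm (f w x *\<^sub>R veronese x) \<le> (norm w * B) * B" if "x \<in> S2" for x
      unfolding norm_scaleR using fK[OF that] B[OF that] order_trans[OF norm_ge_zero B[OF that]]
      by (intro mult_mono) auto
  qed
  define G where "G w = (\<integral>x. f w x *\<^sub>R veronese x \<partial>\<rho>)" for w
  have G_inner: "v \<bullet> G w = (\<integral>x. f w x * (v \<bullet> veronese x) \<partial>\<rho>)" for v w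
    unfolding G_def using integral_inner_right[of v \<rho>, OF iG[of w]] by simp
  have "linear G"
  proof (rule linearI)
    show "G (v + w) = G v + G w" for v w
      unfolding G_def using iG[of v] iG[of w]
      by (subst Bochner_Integration.integral_add[symmetric])
        (auto simp: f_def inner_add_left algebra_simps)
    show "G (c *\<^sub>R w) = c *\<^sub>R G w" for c w
      unfolding G_def
      by (subst integral_scaleR_right[symmetric]) (auto simp: f_def algebra_simps)
  qed
  then have "subspace (range G)" by (simp add: linear_subspace_image)
  then have spanG: "span (range G) = range G" by (simp add: span_eq_iff)
  obtain y z where yz: "y \<in> span (range G)" "\<And>w. w \<in> span (range G) \<Longrightarrow> orthogonal z w"
      "sphere_mean = y + z"
    using orthogonal_subspace_decomp_exists[of "range G" sphere_mean] by metis
  have "z \<noteq> 0"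
  proof
    assume "z = 0"
    then obtain w where w: "sphere_mean = G w" using yz spanG by auto
    have pot: "f w x * potential \<tau> \<rho> (f w) x = (1 - \<tau>\<^sup>2 / 3) / 2 * f w x" if x: "x \<in> S2" for x
    proof (cases "x \<in> N")
      case False
      then show ?thesis by (simp add: f_def)
    next
      case True
      have "potential \<tau> \<rho> (f w) x = (\<integral>y. f w y * (kernel_covector \<tau> x \<bullet> veronese y) \<partial>\<rho>)"
        unfolding potential_def
      proof (intro Bochner_Integration.integral_cong refl)
        fix y assume "y \<in> space \<rho>"
        then have y: "y \<in> S2" using sp by simp
        show "f w y * lagrangian \<tau> x y = f w y * (kernel_covector \<tau> x \<bullet> veronese y)"
        proof (cases "y \<in> N")
          case False
          then show ?thesis by (simp add: f_def)
        next
          case True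
          have "dist x y \<le> dist a x + dist a y" using dist_triangle[of x y a] by (simp add: dist_commute)
          also have "\<dots> \<le> 2 / \<tau>" using True \<open>x \<in> N\<close> unfolding N_def by simp
          finally show ?thesis
            using lagrangian_eq_causal_D[OF \<tau>0 x y] causal_D_veronese[OF y] by simp
        qed
      qed
      also have "\<dots> = kernel_covector \<tau> x \<bullet> sphere_mean" unfolding w G_inner ..
      finally show ?thesis using kernel_covector_mean[OF x] by simp
    qed
    \<comment> \<open>positivity of the kernel, evaluated on a density of mass one with constant negative potential\<close>
    have "0 \<le> (\<integral>x. f w x * potential \<tau> \<rho> (f w) x \<partial>\<rho>)"
      by (rule minimizer_kernel_positive[OF min fm fK])
    also have "\<dots> = (\<integral>x. (1 - \<tau>\<^sup>2 / 3) / 2 * f w x \<partial>\<rho>)"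
      using sp by (intro Bochner_Integration.integral_cong pot) auto
    also have "\<dots> = (1 - \<tau>\<^sup>2 / 3) / 2 * (\<integral>x. f w x * ((0, mat 1) \<bullet> veronese x) \<partial>\<rho>)"
    proof -
      have "(0, mat 1) \<bullet> veronese x = 1" if "x \<in> space \<rho>" for x
        using that sp by (simp add: inner_veronese quad_def dot_square_norm)
      then show ?thesis by (simp cong: Bochner_Integration.integral_cong)
    qed
    also have "(\<integral>x. f w x * ((0, mat 1) \<bullet> veronese x) \<partial>\<rho>) = (0, mat 1) \<bullet> sphere_mean"
      unfolding w G_inner ..
    also have "\<dots> = 1" unfolding inner_sphere_mean by (simp add: trace_def mat_def)
    finally show False using \<tau>2 by simp
  qed
  obtain b A where z: "z = (b, A)" by (cases z)
  have "z \<bullet> y = 0" using yz(1,2) by (simp add: orthogonal_def)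
  then have "z \<bullet> sphere_mean = z \<bullet> z" unfolding yz(3) by (simp add: inner_add_right)
  moreover have "z \<bullet> z \<noteq> 0" using \<open>z \<noteq> 0\<close> by simp
  ultimately have "trace A \<noteq> 0" using inner_sphere_mean[of b A] unfolding z by simp
  moreover have "quad b A x = 0" if x: "x \<in> measure_support \<rho> \<inter> N" for x
  proof (rule ccontr)
    assume nz: "quad b A x \<noteq> 0"
    have "z \<bullet> G z = 0" using yz(2)[of "G z"] spanG by (simp add: orthogonal_def)
    then have "(\<integral>x. f z x * (z \<bullet> veronese x) \<partial>\<rho>) = 0" by (simp add: G_inner)
    moreover have "integrable \<rho> (\<lambda>x. f z x * (z \<bullet> veronese x))"
      using integrable_inner_right[of z \<rho>, OF iG[of z]] by simp
    moreover have "AE x in \<rho>. 0 \<le> f z x * (z \<bullet> veronese x)"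
      by (auto simp: f_def indicator_def)
    ultimately have ae: "AE x in \<rho>. f z x * (z \<bullet> veronese x) = 0"
      using integral_nonneg_eq_0_iff_AE by blast
    \<comment> \<open>a neighbourhood of \<open>x\<close> in the sphere on which the vanishing integrand is positive\<close>
    define U where "U = S2 \<inter> (N \<inter> {x. z \<bullet> veronese x \<noteq> 0})"
    have "open {x. z \<bullet> veronese x \<noteq> 0}"
      by (intro open_Collect_neq continuous_intros continuous_on_veronese)
    then have "open (N \<inter> {x. z \<bullet> veronese x \<noteq> 0})" unfolding N_def by auto
    then have opU: "openin (top_of_set S2) U" unfolding U_def by (simp add: openin_open_Int)
    have Us: "U \<in> sets \<rho>"
      using \<open>open (N \<inter> {x. z \<bullet> veronese x \<noteq> 0})\<close> unfolding ss U_def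
      by (auto simp: sets_restrict_space)
    have xU: "x \<in> U" using x nz sp inner_veronese[of b A x] z by (auto simp: U_def measure_support_def)
    have "emeasure \<rho> U > 0" using x opU xU sp by (auto simp: measure_support_def)
    moreover have "AE x in \<rho>. x \<notin> U"
      using ae by eventually_elim (auto simp: U_def f_def)
    then have "emeasure \<rho> U = 0" using Us sets.sets_into_space[OF Us]
      by (subst (asm) AE_iff_measurable[OF Us]) auto
    ultimately show False by simp
  qed
  ultimately show ?thesis unfolding N_def by blast
qed

lemma support_in_finitely_many_quadrics:
  assumes "\<tau> > sqrt 3" "minimizing_measure \<tau> \<rho>"
  shows "\<exists>Q. finite Q \<and> (\<forall>(b, A) \<in> Q. trace A \<noteq> 0) \<and>
           measure_support \<rho> \<subseteq> (\<Union>(b, A) \<in> Q. {x \<in> S2. quad b A x = 0})"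
proof -
  have \<tau>0: "\<tau> > 0" using assms(1) by (meson less_trans real_sqrt_gt_zero zero_less_numeral)
  have "\<forall>a. \<exists>p. trace (snd p) \<noteq> 0 \<and>
      (\<forall>x \<in> measure_support \<rho> \<inter> ball a (1 / \<tau>). quad (fst p) (snd p) x = 0)"
  proof
    fix a
    obtain b A where "trace A \<noteq> 0" "\<forall>x \<in> measure_support \<rho> \<inter> ball a (1 / \<tau>). quad b A x = 0"
      using support_locally_in_quadric[OF assms, of a] by blast
    then show "\<exists>p. trace (snd p) \<noteq> 0 \<and>
      (\<forall>x \<in> measure_support \<rho> \<inter> ball a (1 / \<tau>). quad (fst p) (snd p) x = 0)"
      by (intro exI[of _ "(b, A)"]) simp
  qed
  then obtain p where p: "\<forall>a. trace (snd (p a)) \<noteq> 0 \<and>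
      (\<forall>x \<in> measure_support \<rho> \<inter> ball a (1 / \<tau>). quad (fst (p a)) (snd (p a)) x = 0)"
    using choice[of "\<lambda>a p. trace (snd p) \<noteq> 0 \<and>
      (\<forall>x \<in> measure_support \<rho> \<inter> ball a (1 / \<tau>). quad (fst p) (snd p) x = 0)"] by blast
  have cover: "S2 \<subseteq> (\<Union>a \<in> S2. ball a (1 / \<tau>))"
  proof
    fix x :: "real ^ 3"
    assume "x \<in> S2"
    then show "x \<in> (\<Union>a \<in> S2. ball a (1 / \<tau>))" using \<tau>0 by (intro UN_I[of x]) simp_all
  qed
  then obtain P where P: "P \<subseteq> S2" "finite P" "S2 \<subseteq> (\<Union>a \<in> P. ball a (1 / \<tau>))"
    using compactE_image[OF compact_sphere open_ball cover] by metis
  have sub: "measure_support \<rho> \<subseteq> S2"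
  proof -
    have "\<rho> \<in> admissible_measures" using assms(2) unfolding minimizing_measure_def by blast
    then have "space \<rho> = S2" unfolding admissible_iff by blast
    then show ?thesis unfolding measure_support_def by blast
  qed
  have "measure_support \<rho> \<subseteq> (\<Union>(b, A) \<in> p ` P. {x \<in> S2. quad b A x = 0})"
  proof
    fix x assume x: "x \<in> measure_support \<rho>"
    then obtain a where a: "a \<in> P" "x \<in> ball a (1 / \<tau>)" using P(3) sub by blast
    then have "quad (fst (p a)) (snd (p a)) x = 0" using p x by blast
    then show "x \<in> (\<Union>(b, A) \<in> p ` P. {x \<in> S2. quad b A x = 0})"
      using a(1) x sub by (auto simp: case_prod_beta)
  qed
  moreover have "\<forall>(b, A) \<in> p ` P. trace A \<noteq> 0" using p by (auto simp: case_prod_beta)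
  ultimately show ?thesis using P(2) by blast
qed

section \<open>Holomorphic arcs\<close>

text \<open>Arcs are parametrized by functions that are holomorphic on a connected complex neighbourhood of the interval
  and real on the interval itself, so that the identity theorem applies to polynomials in the coordinates.
  Infiniteness of the trace expresses that the parametrization is not constant.\<close>

definition holo_arc :: "(real ^ 3) set \<Rightarrow> bool" where
  "holo_arc C \<longleftrightarrow> infinite C \<and>
     (\<exists>F S a b. a < b \<and> open S \<and> connected S \<and> complex_of_real ` {a..b} \<subseteq> S \<and>
        (\<forall>i. F i holomorphic_on S) \<and> (\<forall>i. \<forall>t \<in> {a..b}. F i (of_real t) \<in> \<real>) \<and>
        C = (\<lambda>t. \<chi> i. Re (F i (of_real t))) ` {a..b})"

lemma holo_arcE:
  assumes "holo_arc C"
  obtains F S a b where "infinite C" "a < b" "open S" "connected S" "complex_of_real ` {a..b} \<subseteq> S"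
    "\<And>i. F i holomorphic_on S" "\<And>i t. t \<in> {a..b} \<Longrightarrow> F i (of_real t) \<in> \<real>"
    "C = (\<lambda>t. \<chi> i. Re (F i (of_real t))) ` {a..b}"
proof -
  have inf: "infinite C" using assms unfolding holo_arc_def by (rule conjunct1)
  have "\<exists>F S a b. a < b \<and> open S \<and> connected S \<and> complex_of_real ` {a..b} \<subseteq> S \<and>
        (\<forall>i. F i holomorphic_on S) \<and> (\<forall>i. \<forall>t \<in> {a..b}. F i (of_real t) \<in> \<real>) \<and>
        C = (\<lambda>t. \<chi> i. Re (F i (of_real t))) ` {a..b}"
    using assms unfolding holo_arc_def by (rule conjunct2)
  then obtain F S a b where X: "a < b \<and> open S \<and> connected S \<and> complex_of_real ` {a..b} \<subseteq> S \<and>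
        (\<forall>i. F i holomorphic_on S) \<and> (\<forall>i. \<forall>t \<in> {a..b}. F i (of_real t) \<in> \<real>) \<and>
        C = (\<lambda>t. \<chi> i. Re (F i (of_real t))) ` {a..b}"
    by (elim exE) (rule that)
  show thesis by (rule that[OF inf, of a b S F]) (use X in blast)+
qed

lemma sums_vecI:
  fixes f :: "nat \<Rightarrow> real ^ 'n"
  assumes "\<And>i. (\<lambda>n. f n $ i) sums (l $ i)"
  shows "f sums l"
  using assms unfolding sums_def by (intro vec_tendstoI) simp

lemma real_analytic_on_holomorphic:
  fixes F :: "'n::finite \<Rightarrow> complex \<Rightarrow> complex"
  assumes "open S" "complex_of_real ` T \<subseteq> S" "\<And>i. F i holomorphic_on S"
  shows "real_analytic_on (\<lambda>t. \<chi> i. Re (F i (of_real t))) T"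
  unfolding real_analytic_on_def
proof
  fix t assume "t \<in> T"
  then have "of_real t \<in> S" using assms(2) by auto
  then obtain r where r: "r > 0" "ball (of_real t) r \<subseteq> S"
    using assms(1) by (metis openE)
  define c where "c n = (\<chi> i. Re ((deriv ^^ n) (F i) (of_real t) / fact n))" for n
  have "(\<lambda>n. (s - t) ^ n *\<^sub>R c n) sums (\<chi> i. Re (F i (of_real s)))" if s: "\<bar>s - t\<bar> < r" for s
  proof (rule sums_vecI)
    fix i
    have "F i holomorphic_on ball (of_real t) r"
      using assms(3) r(2) holomorphic_on_subset by blast
    moreover have "of_real s \<in> ball (complex_of_real t) r"
      using s by (simp add: dist_complex_def dist_norm norm_minus_commute del: of_real_diff flip: of_real_diff)
    ultimately have "(\<lambda>n. (deriv ^^ n) (F i) (of_real t) / fact n * (of_real s - of_real t) ^ n)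
        sums F i (of_real s)"
      by (rule holomorphic_power_series)
    then have "(\<lambda>n. Re ((deriv ^^ n) (F i) (of_real t) / fact n * (of_real s - of_real t) ^ n))
        sums Re (F i (of_real s))"
      by (rule sums_Re)
    moreover have "Re (z * (of_real s - of_real t) ^ n) = (s - t) ^ n * Re z" for z n
    proof -
      have "(complex_of_real s - of_real t) ^ n = of_real ((s - t) ^ n)" by simp
      then show ?thesis by (simp only:) (simp add: complex_eq_iff)
    qed
    ultimately show "(\<lambda>n. ((s - t) ^ n *\<^sub>R c n) $ i) sums ((\<chi> i. Re (F i (of_real s))) $ i)"
      by (simp only: c_def vec_lambda_beta vector_scaleR_component real_scaleR_def)
  qed
  then show "\<exists>a r. r > 0 \<and> (\<forall>s. \<bar>s - t\<bar> < r \<longrightarrow>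
      (\<lambda>n. (s - t) ^ n *\<^sub>R a n) sums (\<chi> i. Re (F i (of_real s))))"
    using r(1) by blast
qed

lemma holo_arc_imp_real_analytic_curve:
  assumes "holo_arc C" "C \<subseteq> X"
  shows "real_analytic_curve_in X C"
proof -
  obtain F S a b where *: "a < b" "open S" "complex_of_real ` {a..b} \<subseteq> S"
      "\<And>i. F i holomorphic_on S" "C = (\<lambda>t. \<chi> i. Re (F i (of_real t))) ` {a..b}" "infinite C"
    by (rule holo_arcE[OF assms(1)]) (rule that)
  define g :: "real \<Rightarrow> real ^ 3" where "g = (\<lambda>t. \<chi> i. Re (F i (of_real t)))"
  have "real_analytic_on g {a..b}"
    unfolding g_def by (rule real_analytic_on_holomorphic[OF *(2,3,4)])
  moreover have "\<not> g constant_on {a..b}"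
  proof
    assume "g constant_on {a..b}"
    then obtain c where "\<forall>t \<in> {a..b}. g t = c" unfolding constant_on_def by blast
    then have "C \<subseteq> {c}" using *(5) by (auto simp: g_def)
    then show False using *(6) finite_subset by blast
  qed
  ultimately show ?thesis
    unfolding real_analytic_curve_in_def using *(1,5) assms(2) unfolding g_def by blast
qed

text \<open>The identity theorem as a property of a set. All algebraic sets have it, and it passes to finite unions, which
  are not zero sets of a single quadratic function any more.\<close>

definition arc_rigid :: "(real ^ 3) set \<Rightarrow> bool" where
  "arc_rigid Z \<longleftrightarrow> (\<forall>C. holo_arc C \<and> C \<subseteq> S2 \<longrightarrow> finite (C \<inter> Z) \<or> C \<subseteq> Z)"

lemma arc_rigid_Un:
  assumes "arc_rigid Z" "arc_rigid Z'"
  shows "arc_rigid (Z \<union> Z')"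
  unfolding arc_rigid_def
proof (intro allI impI)
  fix C assume C: "holo_arc C \<and> C \<subseteq> S2"
  then have "finite (C \<inter> Z) \<or> C \<subseteq> Z" "finite (C \<inter> Z') \<or> C \<subseteq> Z'"
    using assms unfolding arc_rigid_def by blast+
  moreover have "C \<inter> (Z \<union> Z') = (C \<inter> Z) \<union> (C \<inter> Z')" by blast
  ultimately show "finite (C \<inter> (Z \<union> Z')) \<or> C \<subseteq> Z \<union> Z'"
    by (metis finite_Un le_supI1 le_supI2)
qed

text \<open>The quadratic polynomial, evaluated along the parametrization, is holomorphic. It is constant, or it has
  finitely many zeros on the compact parameter interval.\<close>

lemma arc_rigid_quadric: "arc_rigid {x \<in> S2. quad b A x = 0}"
  unfolding arc_rigid_def
proof (intro allI impI)
  fix C :: "(real ^ 3) set"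
  assume C: "holo_arc C \<and> C \<subseteq> S2"
  then have "holo_arc C" ..
  then obtain F S l u where *: "l < u" "open S" "connected S" "complex_of_real ` {l..u} \<subseteq> S"
      "\<And>i. F i holomorphic_on S" "\<And>i t. t \<in> {l..u} \<Longrightarrow> F i (of_real t) \<in> \<real>"
      "C = (\<lambda>t. \<chi> i. Re (F i (of_real t))) ` {l..u}"
    by (rule holo_arcE) (rule that)
  define g :: "real \<Rightarrow> real ^ 3" where "g t = (\<chi> i. Re (F i (of_real t)))" for t
  define Q :: "complex \<Rightarrow> complex" where "Q z = (\<Sum>i\<in>UNIV. of_real (b $ i) * F i z)
     + (\<Sum>i\<in>UNIV. \<Sum>j\<in>UNIV. of_real (A $ i $ j) * F j z * F i z)" for z
  have Q_hol: "Q holomorphic_on S"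
    unfolding Q_def by (intro holomorphic_intros *(5))
  have Q_real: "Q (of_real t) = of_real (quad b A (g t))" if "t \<in> {l..u}" for t
  proof -
    have "F i (of_real t) = of_real (g t $ i)" for i
      using *(6)[OF that, of i] by (simp add: g_def)
    then have "Q (of_real t) = of_real ((\<Sum>i\<in>UNIV. b $ i * g t $ i)
        + (\<Sum>i\<in>UNIV. \<Sum>j\<in>UNIV. A $ i $ j * g t $ j * g t $ i))"
      by (simp add: Q_def)
    also have "(\<Sum>i\<in>UNIV. b $ i * g t $ i) + (\<Sum>i\<in>UNIV. \<Sum>j\<in>UNIV. A $ i $ j * g t $ j * g t $ i)
        = quad b A (g t)"
      by (simp add: quad_def inner_vec_def matrix_vector_mult_def sum_distrib_left mult.commute)
    finally show ?thesis .
  qed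
  have Cg: "C = g ` {l..u}" using *(7) by (simp add: g_def)
  show "finite (C \<inter> {x \<in> S2. quad b A x = 0}) \<or> C \<subseteq> {x \<in> S2. quad b A x = 0}"
  proof (cases "Q constant_on S")
    case True
    then obtain c where c: "\<And>z. z \<in> S \<Longrightarrow> Q z = c" unfolding constant_on_def by blast
    have "of_real (quad b A (g t)) = c" if "t \<in> {l..u}" for t
    proof -
      have "complex_of_real t \<in> S" using *(4) that by blast
      then show ?thesis using c Q_real[OF that] by metis
    qed
    then have "quad b A x = Re c" if x: "x \<in> C" for x
    proof -
      obtain t where t: "t \<in> {l..u}" "x = g t" using x unfolding Cg by blast
      then have "complex_of_real (quad b A x) = c"
        using \<open>\<And>t. t \<in> {l..u} \<Longrightarrow> complex_of_real (quad b A (g t)) = c\<close> by blast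
      then show ?thesis by (metis Re_complex_of_real)
    qed
    then have "C \<subseteq> {x \<in> S2. quad b A x = 0}" if "Re c = 0" using that C by auto
    moreover have "C \<inter> {x \<in> S2. quad b A x = 0} = {}" if "Re c \<noteq> 0"
      using that \<open>\<And>x. x \<in> C \<Longrightarrow> quad b A x = Re c\<close> by auto
    ultimately show ?thesis by (cases "Re c = 0") simp_all
  next
    case False
    have "compact (complex_of_real ` {l..u})"
      by (intro compact_continuous_image continuous_intros) auto
    then have "finite {z \<in> complex_of_real ` {l..u}. Q z = 0}"
      using holomorphic_compact_finite_zeros[OF Q_hol *(2,3) _ *(4) False] by blast
    then have "finite ((\<lambda>z. g (Re z)) ` {z \<in> complex_of_real ` {l..u}. Q z = 0})"
      by (rule finite_imageI)
    moreover have "C \<inter> {x \<in> S2. quad b A x = 0} \<subseteq> (\<lambda>z. g (Re z)) ` {z \<in> complex_of_real ` {l..u}. Q z = 0}"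
    proof
      fix x assume "x \<in> C \<inter> {x \<in> S2. quad b A x = 0}"
      then obtain t where t: "t \<in> {l..u}" "x = g t" "quad b A (g t) = 0" unfolding Cg by auto
      then have "of_real t \<in> {z \<in> complex_of_real ` {l..u}. Q z = 0}" using Q_real by auto
      then show "x \<in> (\<lambda>z. g (Re z)) ` {z \<in> complex_of_real ` {l..u}. Q z = 0}"
        using t(2) by (intro image_eqI[of _ _ "of_real t"]) auto
    qed
    ultimately show ?thesis using finite_subset by blast
  qed
qed

section \<open>Families of arcs\<close>

definition arc_family :: "(real ^ 3) set set \<Rightarrow> bool" where
  "arc_family F \<longleftrightarrow> finite F \<and> (\<forall>C \<in> F. holo_arc C \<and> C \<subseteq> S2) \<and> pairwise (\<lambda>C C'. finite (C \<inter> C')) F"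

lemma arc_family_Un:
  assumes F: "arc_family F" and G: "arc_family G"
    and fin: "\<And>C C'. C \<in> F \<Longrightarrow> C' \<in> G \<Longrightarrow> finite (C \<inter> C')"
  shows "arc_family (F \<union> G)"
  unfolding arc_family_def
proof (intro conjI)
  show "finite (F \<union> G)" using F G unfolding arc_family_def by simp
  show "\<forall>C \<in> F \<union> G. holo_arc C \<and> C \<subseteq> S2" using F G unfolding arc_family_def by blast
  show "pairwise (\<lambda>C C'. finite (C \<inter> C')) (F \<union> G)"
  proof (rule pairwiseI)
    fix C C' assume CC: "C \<in> F \<union> G" "C' \<in> F \<union> G" "C \<noteq> C'"
    have 1: "finite (C \<inter> C')" if "C \<in> F" "C' \<in> F"
      using that CC(3) F unfolding arc_family_def pairwise_def by blast
    have 2: "finite (C \<inter> C')" if "C \<in> G" "C' \<in> G"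
      using that CC(3) G unfolding arc_family_def pairwise_def by blast
    show "finite (C \<inter> C')" using CC 1 2 fin[of C C'] fin[of C' C] by (auto simp: Int_commute)
  qed
qed

text \<open>The sets that are already organized as the theorem demands and that can still be enlarged.\<close>

definition curvilinear :: "(real ^ 3) set \<Rightarrow> bool" where
  "curvilinear Z \<longleftrightarrow> arc_rigid Z \<and> (\<exists>F. arc_family F \<and> \<Union>F = Z)"

lemma curvilinear_empty: "curvilinear {}"
  unfolding curvilinear_def arc_rigid_def arc_family_def by (auto intro!: exI[of _ "{}"])

text \<open>Of the new arcs only those not contained in \<open>Z\<close> are kept. These meet \<open>Z\<close>, and so every arc of the
  old family, in finitely many points by rigidity of \<open>Z\<close>. What the new arcs omit of \<open>Z'\<close> only has to lie in \<open>Z\<close>.\<close>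

lemma curvilinear_Un:
  assumes Z: "curvilinear Z" and Z': "arc_rigid Z'" and F': "arc_family F'" "\<Union>F' \<subseteq> Z'" "Z' \<subseteq> \<Union>F' \<union> Z"
  shows "curvilinear (Z \<union> Z')"
proof -
  obtain F where F: "arc_rigid Z" "arc_family F" "\<Union>F = Z" using Z unfolding curvilinear_def by blast
  define G where "G = {C \<in> F'. \<not> C \<subseteq> Z}"
  have fin: "finite (C \<inter> C')" if "C \<in> F" "C' \<in> G" for C C'
  proof -
    have "finite (C' \<inter> Z)" using that F'(1) F(1) unfolding G_def arc_family_def arc_rigid_def by blast
    moreover have "C \<inter> C' \<subseteq> C' \<inter> Z" using that F(3) by blast
    ultimately show ?thesis by (metis finite_subset)
  qed
  have "arc_family G" using F'(1) unfolding arc_family_def G_def pairwise_def by simp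
  then have "arc_family (F \<union> G)" using F(2) fin by (intro arc_family_Un)
  moreover have "\<Union>(F \<union> G) = Z \<union> Z'"
    using F(3) F'(2,3) unfolding G_def by blast
  ultimately show ?thesis
    using arc_rigid_Un[OF F(1) Z'] unfolding curvilinear_def by blast
qed

section \<open>Orthonormal frames and circles\<close>

definition frame :: "real ^ 3 \<Rightarrow> real ^ 3 \<Rightarrow> real ^ 3 \<Rightarrow> bool" where
  "frame e w n \<longleftrightarrow> e \<bullet> e = 1 \<and> w \<bullet> w = 1 \<and> n \<bullet> n = 1 \<and> e \<bullet> w = 0 \<and> e \<bullet> n = 0 \<and> w \<bullet> n = 0"

lemma frame_expand:
  assumes "frame e w n"
  shows "x = (x \<bullet> e) *\<^sub>R e + (x \<bullet> w) *\<^sub>R w + (x \<bullet> n) *\<^sub>R n"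
proof (rule ccontr)
  assume ne: "\<not> ?thesis"
  define y where "y = x - ((x \<bullet> e) *\<^sub>R e + (x \<bullet> w) *\<^sub>R w + (x \<bullet> n) *\<^sub>R n)"
  have f: "e \<bullet> e = 1" "w \<bullet> w = 1" "n \<bullet> n = 1" "e \<bullet> w = 0" "e \<bullet> n = 0" "w \<bullet> n = 0"
      "w \<bullet> e = 0" "n \<bullet> e = 0" "n \<bullet> w = 0"
    using assms by (auto simp: frame_def inner_commute)
  have y0: "y \<noteq> 0" using ne by (auto simp: y_def)
  have yo: "y \<bullet> e = 0" "y \<bullet> w = 0" "y \<bullet> n = 0"
    unfolding y_def by (simp_all add: inner_diff_left inner_add_left f)
  have "pairwise orthogonal {y, e, w, n}" using yo f
    by (auto simp: pairwise_def orthogonal_def inner_commute)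
  moreover have "0 \<notin> {y, e, w, n}" using y0 f by auto
  ultimately have ind: "independent {y, e, w, n}" by (rule pairwise_orthogonal_independent)
  have "e \<noteq> w" "e \<noteq> n" "w \<noteq> n" "y \<noteq> e" "y \<noteq> w" "y \<noteq> n" using f yo by auto
  then have "card {y, e, w, n} = 4" by simp
  then show False using independent_card_le[OF ind] by simp
qed

lemma exists_unit_orthogonal:
  fixes u v :: "real ^ 3"
  shows "\<exists>e. e \<bullet> e = 1 \<and> e \<bullet> u = 0 \<and> e \<bullet> v = 0"
proof -
  have "dim {u, v} \<le> card {u, v}" by (rule dim_le_card') simp
  also have "\<dots> \<le> 2" by (simp add: card_insert_if)
  finally have "dim {u, v} < DIM(real ^ 3)" by simp
  then obtain x where x: "x \<noteq> 0" "\<And>y. y \<in> span {u, v} \<Longrightarrow> orthogonal x y"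
    using orthogonal_to_subspace_exists by blast
  have "x \<bullet> u = 0" "x \<bullet> v = 0"
    using x(2)[of u] x(2)[of v] by (auto simp: orthogonal_def span_base)
  then show ?thesis using x(1)
    by (intro exI[of _ "(1 / norm x) *\<^sub>R x"]) (auto simp: dot_square_norm power2_eq_square)
qed

lemma exists_frame:
  assumes "p \<bullet> p = 1"
  shows "\<exists>e w. frame e w p \<and> w \<bullet> g = 0"
proof -
  obtain w where w: "w \<bullet> w = 1" "w \<bullet> p = 0" "w \<bullet> g = 0"
    using exists_unit_orthogonal by blast
  obtain e where "e \<bullet> e = 1" "e \<bullet> w = 0" "e \<bullet> p = 0"
    using exists_unit_orthogonal by blast
  with w assms show ?thesis unfolding frame_def by blast
qed

lemma frame_inner:
  assumes "frame e w n"
  shows "(a *\<^sub>R e + b *\<^sub>R w + c *\<^sub>R n) \<bullet> (a' *\<^sub>R e + b' *\<^sub>R w + c' *\<^sub>R n) = a * a' + b * b' + c * c'"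
proof -
  have f: "e \<bullet> e = 1" "w \<bullet> w = 1" "n \<bullet> n = 1" "e \<bullet> w = 0" "e \<bullet> n = 0" "w \<bullet> n = 0"
      "w \<bullet> e = 0" "n \<bullet> e = 0" "n \<bullet> w = 0"
    using assms by (auto simp: frame_def inner_commute)
  show ?thesis by (simp add: inner_add_left inner_add_right f)
qed

lemma holo_arc_circle:
  fixes n :: "real ^ 3"
  assumes n: "n \<bullet> n = 1" and d: "\<bar>d\<bar> < 1"
  shows "holo_arc {x \<in> S2. n \<bullet> x = d}"
proof -
  obtain e w where fr: "frame e w n" using exists_frame[OF n] by blast
  define r where "r = sqrt (1 - d\<^sup>2)"
  have d2: "d\<^sup>2 < 1" using d by (simp add: abs_square_less_1)
  have r: "r > 0" "r\<^sup>2 = 1 - d\<^sup>2" using d2 by (auto simp: r_def)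
  define g where "g t = (r * cos t) *\<^sub>R e + (r * sin t) *\<^sub>R w + d *\<^sub>R n" for t
  define F where "F i z = of_real (r * e $ i) * cos z + of_real (r * w $ i) * sin z + of_real (d * n $ i)"
    for i :: 3 and z :: complex
  have FR: "F i (of_real t) = of_real (g t $ i)" for i t
    unfolding F_def g_def by (simp add: cos_of_real sin_of_real algebra_simps)
  have gF: "g t = (\<chi> i. Re (F i (of_real t)))" for t
    by (simp add: FR)
  have im: "{x \<in> S2. n \<bullet> x = d} = g ` {0..2 * pi}"
  proof (intro equalityI subsetI)
    fix x assume "x \<in> g ` {0..2 * pi}"
    then obtain t where x: "x = g t" by blast
    have "x \<bullet> x = (r * cos t) * (r * cos t) + (r * sin t) * (r * sin t) + d * d"
      unfolding x g_def by (rule frame_inner[OF fr])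
    also have "\<dots> = r\<^sup>2 * ((cos t)\<^sup>2 + (sin t)\<^sup>2) + d\<^sup>2"
      by (simp only: power2_eq_square algebra_simps)
    also have "\<dots> = 1" using r(2) by simp
    finally have "x \<in> S2" by (simp add: norm_eq_1)
    moreover have "n \<bullet> x = d"
      using frame_inner[OF fr, of 0 0 1 "r * cos t" "r * sin t" d] unfolding x g_def by simp
    ultimately show "x \<in> {x \<in> S2. n \<bullet> x = d}" by simp
  next
    fix x assume "x \<in> {x \<in> S2. n \<bullet> x = d}"
    then have x: "x \<bullet> x = 1" "x \<bullet> n = d" by (auto simp: norm_eq_1 inner_commute)
    define \<xi> \<eta> where "\<xi> = x \<bullet> e" and "\<eta> = x \<bullet> w"
    have xe: "x = \<xi> *\<^sub>R e + \<eta> *\<^sub>R w + d *\<^sub>R n" using frame_expand[OF fr, of x] x(2) by (simp add: \<xi>_def \<eta>_def)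
    have "\<xi> * \<xi> + \<eta> * \<eta> + d * d = 1" using x(1) frame_inner[OF fr, of \<xi> \<eta> d \<xi> \<eta> d] xe by simp
    then have "(\<xi> / r)\<^sup>2 + (\<eta> / r)\<^sup>2 = 1"
      using r d2 by (simp add: power_divide power2_eq_square field_simps)
    then obtain t where t: "0 \<le> t" "t < 2 * pi" "\<xi> / r = cos t" "\<eta> / r = sin t"
      by (rule sincos_total_2pi)
    then have "\<xi> = r * cos t" "\<eta> = r * sin t" using r(1) by (simp_all add: field_simps)
    then have "x = g t" using xe by (simp add: g_def)
    then show "x \<in> g ` {0..2 * pi}" using t(1,2) by auto
  qed
  \<comment> \<open>half a turn is enough to see that the circle is infinite\<close>
  have "inj_on g {0..pi}"
  proof (rule inj_onI)
    fix s t assume st: "s \<in> {0..pi}" "t \<in> {0..pi}" "g s = g t"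
    have "g s \<bullet> e = r * cos s" for s
      using frame_inner[OF fr, of "r * cos s" "r * sin s" d 1 0 0] by (simp add: g_def)
    then have "cos s = cos t" using st(3) r(1) by (metis mult_cancel_left less_irrefl)
    then show "s = t" using st(1,2) by (auto intro: cos_inj_pi)
  qed
  moreover have "infinite {0..pi}" by simp
  ultimately have "infinite (g ` {0..pi})" by (simp add: finite_image_iff)
  then have inf: "infinite (g ` {0..2 * pi})"
    by (rule infinite_super[rotated]) auto
  show ?thesis
    unfolding holo_arc_def im
  proof (rule conjI[OF inf], rule exI[of _ F], rule exI[of _ UNIV], rule exI[of _ 0],
      rule exI[of _ "2 * pi"], intro conjI allI ballI)
    show "F i holomorphic_on UNIV" for i unfolding F_def by (intro holomorphic_intros)
    show "F i (of_real t) \<in> \<real>" for i t by (simp add: FR)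
    show "g ` {0..2 * pi} = (\<lambda>t. \<chi> i. Re (F i (of_real t))) ` {0..2 * pi}"
      using gF by (intro image_cong) auto
  qed auto
qed

section \<open>Discarding common arcs\<close>

lemma curvilinear_great_circles:
  assumes "finite E" "E \<subseteq> S2"
  shows "\<exists>Z. curvilinear Z \<and> E \<subseteq> Z"
  using assms
proof (induction E rule: finite_induct)
  case empty
  then show ?case using curvilinear_empty by blast
next
  case (insert x E)
  then obtain Z where Z: "curvilinear Z" "E \<subseteq> Z" by auto
  obtain n where n: "n \<bullet> n = 1" "n \<bullet> x = 0" using exists_unit_orthogonal[of x x] by blast
  define K where "K = {y \<in> S2. n \<bullet> y = 0}"
  have "holo_arc K" unfolding K_def using holo_arc_circle[OF n(1), of 0] by simp
  then have "arc_family {K}" unfolding arc_family_def K_def by (auto simp: pairwise_def)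
  moreover have "arc_rigid K"
    using arc_rigid_quadric[of n 0] unfolding K_def quad_def by simp
  ultimately have "curvilinear (Z \<union> K)"
    using curvilinear_Un[OF Z(1)] by auto
  moreover have "x \<in> K" using insert.prems n(2) unfolding K_def by simp
  ultimately show ?case using Z(2) by (intro exI[of _ "Z \<union> K"]) auto
qed

text \<open>The finite sets \<open>E\<close> of points missed by the arcs are first covered by great circles. Then the quadrics are
  added one after the other.\<close>

lemma curvilinear_cover_quadrics:
  assumes "finite Q"
    and "\<And>b A. (b, A) \<in> Q \<Longrightarrow> \<exists>F E. arc_family F \<and> finite E \<and> E \<subseteq> S2 \<and>
       \<Union>F \<subseteq> {x \<in> S2. quad b A x = 0} \<and> {x \<in> S2. quad b A x = 0} \<subseteq> \<Union>F \<union> E"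
  shows "\<exists>Z. curvilinear Z \<and> (\<Union>(b, A) \<in> Q. {x \<in> S2. quad b A x = 0}) \<subseteq> Z"
proof -
  let ?V = "\<lambda>q. {x \<in> S2. quad (fst q) (snd q) x = 0}"
  have "\<forall>q \<in> Q. \<exists>E. finite E \<and> E \<subseteq> S2 \<and> (\<exists>F. arc_family F \<and> \<Union>F \<subseteq> ?V q \<and> ?V q \<subseteq> \<Union>F \<union> E)"
  proof
    fix q assume "q \<in> Q"
    then obtain F E where "arc_family F" "finite E" "E \<subseteq> S2" "\<Union>F \<subseteq> ?V q" "?V q \<subseteq> \<Union>F \<union> E"
      using assms(2)[of "fst q" "snd q"] by auto
    then show "\<exists>E. finite E \<and> E \<subseteq> S2 \<and> (\<exists>F. arc_family F \<and> \<Union>F \<subseteq> ?V q \<and> ?V q \<subseteq> \<Union>F \<union> E)"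
      by blast
  qed
  then obtain E where E: "\<forall>q \<in> Q. finite (E q) \<and> E q \<subseteq> S2 \<and>
      (\<exists>F. arc_family F \<and> \<Union>F \<subseteq> ?V q \<and> ?V q \<subseteq> \<Union>F \<union> E q)"
    by (rule bchoice[THEN exE])
  obtain Z where Z: "curvilinear Z" "(\<Union>q\<in>Q. E q) \<subseteq> Z"
  proof -
    have "finite (\<Union>q\<in>Q. E q)" using E assms(1) by blast
    moreover have "(\<Union>q\<in>Q. E q) \<subseteq> S2" using E by blast
    ultimately show ?thesis using curvilinear_great_circles that by metis
  qed
  have "\<exists>Z'. curvilinear Z' \<and> Z \<subseteq> Z' \<and> (\<Union>q\<in>P. ?V q) \<subseteq> Z'" if "finite P" "P \<subseteq> Q" for P
    using that
  proof (induction P rule: finite_induct)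
    case empty
    then show ?case using Z(1) by blast
  next
    case (insert q P)
    then obtain Z' where Z': "curvilinear Z'" "Z \<subseteq> Z'" "(\<Union>q\<in>P. ?V q) \<subseteq> Z'" by blast
    have q: "q \<in> Q" using insert.prems by simp
    then obtain F where F: "arc_family F" "\<Union>F \<subseteq> ?V q" "?V q \<subseteq> \<Union>F \<union> E q"
      using bspec[OF E q] by (elim conjE exE) (rule that)
    have "E q \<subseteq> Z'" using Z(2) Z'(2) q by blast
    then have c: "?V q \<subseteq> \<Union>F \<union> Z'" using F(3) by blast
    have "curvilinear (Z' \<union> ?V q)"
      by (rule curvilinear_Un[OF Z'(1) arc_rigid_quadric F(1,2) c])
    moreover have "Z \<subseteq> Z' \<union> ?V q" using Z'(2) by blast
    moreover have "(\<Union>q\<in>insert q P. ?V q) \<subseteq> Z' \<union> ?V q" using Z'(3) by blast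
    ultimately show ?case by blast
  qed
  then obtain Z' where "curvilinear Z'" "(\<Union>q\<in>Q. ?V q) \<subseteq> Z'" using assms(1) by blast
  moreover have "(\<Union>(b, A) \<in> Q. {x \<in> S2. quad b A x = 0}) = (\<Union>q\<in>Q. ?V q)"
    by (intro SUP_cong refl) (simp add: case_prod_beta)
  ultimately show ?thesis by (intro exI[of _ Z']) simp
qed

section \<open>Real meromorphic germs\<close>

text \<open>A pole would be visible along every path into \<open>0\<close>, so boundedness on the positive half-axis is enough for
  the singularity to be removable.\<close>

lemma meromorphic_bounded_extension:
  assumes mero: "f meromorphic_on {0}" and e: "0 < \<epsilon>"
    and bd: "\<And>s. 0 < s \<Longrightarrow> s < \<epsilon> \<Longrightarrow> norm (f (of_real s)) \<le> K"
  shows "\<exists>\<delta>>0. \<exists>F. F holomorphic_on ball 0 \<delta> \<and> (\<forall>s. 0 < s \<and> s < \<delta> \<longrightarrow> F (of_real s) = f (of_real s))"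
proof -
  have iso: "isolated_singularity_at f 0" and ness: "not_essential f 0"
    using mero by (auto simp: meromorphic_at_iff)
  have lim: "filterlim complex_of_real (at 0) (at_right 0)"
    unfolding filterlim_at
    by (auto intro!: tendsto_eq_intros simp: eventually_at_filter)
  have ev: "\<forall>\<^sub>F s in at_right 0. norm (f (of_real s)) \<le> K"
    unfolding eventually_at_right_field using e bd by (intro exI[of _ \<epsilon>]) simp
  have "\<not> is_pole f 0"
  proof
    assume "is_pole f 0"
    then have "filterlim (\<lambda>s. f (of_real s)) at_infinity (at_right 0)"
      unfolding is_pole_def by (rule filterlim_compose[OF _ lim])
    then have "filterlim (\<lambda>s. norm (f (complex_of_real s))) at_top (at_right 0)"
      by (rule filterlim_at_infinity_imp_norm_at_top)
    then have "\<forall>\<^sub>F s in at_right 0. K + 1 \<le> norm (f (complex_of_real s))"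
      unfolding filterlim_at_top by (rule spec)
    with ev have "\<forall>\<^sub>F s in at_right (0::real). False"
      by eventually_elim simp
    then show False by simp
  qed
  then obtain c where c: "f \<midarrow>0\<rightarrow> c" using ness unfolding not_essential_def by blast
  obtain S where S: "open S" "0 \<in> S" "remove_sings f holomorphic_on S"
    using remove_sings_analytic_at[OF iso c] unfolding analytic_at by blast
  obtain r where r: "r > 0" "ball 0 r \<subseteq> S" using S(1,2) by (rule openE)
  obtain d where d: "d > 0" "\<And>w. w \<noteq> 0 \<Longrightarrow> dist w 0 < d \<Longrightarrow> remove_sings f w = f w"
    using eventually_remove_sings_eq_at[OF iso] unfolding eventually_at by auto
  show ?thesis
  proof (intro exI[of _ "min r d"] exI[of _ "remove_sings f"] conjI allI impI)
    show "0 < min r d" using r d by simp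
    show "remove_sings f holomorphic_on ball 0 (min r d)"
      by (rule holomorphic_on_subset[OF S(3)]) (use r(2) in auto)
    fix s assume "0 < s \<and> s < min r d"
    then show "remove_sings f (of_real s) = f (of_real s)" by (intro d(2)) auto
  qed
qed

text \<open>Divide by the power \<open>t\<^sup>n\<close> of the order of \<open>h\<close> at \<open>0\<close>. The remaining holomorphic factor \<open>P\<close> is real on the
  half-axis and not zero at \<open>0\<close>, so it keeps the sign of its value \<open>c\<close> there.\<close>

lemma real_meromorphic_factor:
  assumes mero: "h meromorphic_on {0}" and e: "0 < \<epsilon>"
    and real: "\<And>t. 0 < t \<Longrightarrow> t < \<epsilon> \<Longrightarrow> h (of_real t) = of_real (hr t)"
  shows "(\<exists>\<delta>>0. \<forall>t. 0 < t \<and> t < \<delta> \<longrightarrow> hr t = 0) \<or>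
    (\<exists>P n c q \<delta>. 0 < \<delta> \<and> P holomorphic_on ball 0 \<delta> \<and> P 0 = complex_of_real c \<and> c \<noteq> 0 \<and>
       (\<forall>t. 0 < t \<and> t < \<delta> \<longrightarrow> P (of_real t) = of_real (q t) \<and> hr t = q t * t powi n \<and> 0 < q t * c))"
proof (cases "\<exists>\<^sub>F w in at 0. h w \<noteq> 0")
  case False
  then have "\<forall>\<^sub>F w in at 0. h w = 0" by (simp add: not_frequently)
  then obtain d where d: "d > 0" "\<And>w. w \<noteq> 0 \<Longrightarrow> dist w 0 < d \<Longrightarrow> h w = 0"
    unfolding eventually_at by auto
  have "hr t = 0" if "0 < t" "t < min d \<epsilon>" for t
  proof -
    have "h (of_real t) = 0" using that by (intro d(2)) auto
    then show ?thesis using real[of t] that by simp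
  qed
  then have "\<exists>\<delta>>0. \<forall>t. 0 < t \<and> t < \<delta> \<longrightarrow> hr t = 0"
    using d(1) e by (intro exI[of _ "min d \<epsilon>"]) auto
  then show ?thesis by (rule disjI1)
next
  case True
  define P where "P = zor_poly h 0"
  define n where "n = zorder h 0"
  have "P 0 \<noteq> 0 \<and> (\<exists>r. 0 < r \<and> P holomorphic_on cball 0 r
      \<and> (\<forall>w\<in>cball 0 r - {0}. h w = P w * (w - 0) powi n \<and> P w \<noteq> 0))"
    unfolding P_def n_def using mero True
    by (intro zorder_exist) (auto simp: meromorphic_at_iff)
  then obtain r where P0: "P 0 \<noteq> 0" and r: "0 < r" "P holomorphic_on cball 0 r"
      "\<And>w. w \<in> cball 0 r - {0} \<Longrightarrow> h w = P w * (w - 0) powi n" by blast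
  have P_ball: "P holomorphic_on ball 0 r"
    using r(2) by (rule holomorphic_on_subset) auto
  have cont: "isCont P 0"
    using holomorphic_on_imp_continuous_on[OF P_ball] r(1) by (simp add: continuous_on_eq_continuous_at)
  define q where "q t = Re (P (of_real t))" for t
  have Pq: "P (of_real t) = of_real (q t)" "hr t = q t * t powi n" if t: "0 < t" "t < min r \<epsilon>" for t
  proof -
    have "complex_of_real t \<in> cball 0 r - {0}" using t by auto
    then have "of_real (hr t) = P (of_real t) * of_real (t powi n)"
      using r(3)[of "of_real t"] real[of t] t by simp
    then have "P (of_real t) = of_real (hr t) / of_real (t powi n)"
      using t by (simp add: field_simps)
    then have *: "P (of_real t) = of_real (hr t / t powi n)" by (simp only: of_real_divide)
    then have "q t = hr t / t powi n" unfolding q_def by (metis Re_complex_of_real)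
    with * show "P (of_real t) = of_real (q t)" "hr t = q t * t powi n" using t by simp_all
  qed
  have lim0: "((\<lambda>t. P (of_real t)) \<longlongrightarrow> P 0) (at_right 0)"
  proof (rule isCont_tendsto_compose[OF cont])
    show "(complex_of_real \<longlongrightarrow> 0) (at_right 0)" by (auto intro!: tendsto_eq_intros)
  qed
  have pos: "\<forall>\<^sub>F t in at_right 0. 0 < t \<and> t < min r \<epsilon>"
    unfolding eventually_at_right_field using e r(1) by (intro exI[of _ "min r \<epsilon>"]) simp
  have "P 0 \<in> \<real>"
  proof (rule Lim_in_closed_set[OF closed_complex_Reals _ _ lim0])
    show "\<forall>\<^sub>F t in at_right 0. P (of_real t) \<in> \<real>"
      using pos by eventually_elim (simp add: Pq)
  qed simp
  then obtain c where c: "P 0 = of_real c" by (auto elim: Reals_cases)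
  have c0: "c \<noteq> 0" using P0 c by auto
  have "(q \<longlongrightarrow> c) (at_right 0)"
    using tendsto_Re[OF lim0] unfolding q_def c by simp
  then have "((\<lambda>t. q t * c) \<longlongrightarrow> c * c) (at_right 0)"
    by (rule tendsto_mult) (rule tendsto_const)
  moreover have "0 < c * c" using c0 by (metis not_real_square_gt_zero)
  ultimately have "\<forall>\<^sub>F t in at_right 0. 0 < q t * c" by (rule order_tendstoD(1))
  then obtain b where b: "b > 0" "\<And>t. 0 < t \<Longrightarrow> t < b \<Longrightarrow> 0 < q t * c"
    unfolding eventually_at_right_field by auto
  define \<delta> where "\<delta> = min b (min r \<epsilon>)"
  have "0 < \<delta> \<and> P holomorphic_on ball 0 \<delta> \<and> P 0 = complex_of_real c \<and> c \<noteq> 0 \<and>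
       (\<forall>t. 0 < t \<and> t < \<delta> \<longrightarrow> P (of_real t) = of_real (q t) \<and> hr t = q t * t powi n \<and> 0 < q t * c)"
  proof (intro conjI allI impI c c0)
    show "0 < \<delta>" using b(1) r(1) e by (simp add: \<delta>_def)
    show "P holomorphic_on ball 0 \<delta>"
      by (rule holomorphic_on_subset[OF P_ball]) (auto simp: \<delta>_def)
  next
    fix t assume "0 < t \<and> t < \<delta>"
    then show "P (of_real t) = of_real (q t)" "hr t = q t * t powi n" "0 < q t * c"
      using Pq b(2) by (auto simp: \<delta>_def)
  qed
  then show ?thesis by blast
qed

lemma real_meromorphic_sign:
  assumes "h meromorphic_on {0}" and "0 < \<epsilon>"
    and "\<And>t. 0 < t \<Longrightarrow> t < \<epsilon> \<Longrightarrow> h (of_real t) = of_real (hr t)"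
  shows "\<exists>\<delta>>0. (\<forall>t. 0 < t \<and> t < \<delta> \<longrightarrow> hr t = 0) \<or> (\<forall>t. 0 < t \<and> t < \<delta> \<longrightarrow> 0 < hr t) \<or>
    (\<forall>t. 0 < t \<and> t < \<delta> \<longrightarrow> hr t < 0)"
proof -
  note factor = real_meromorphic_factor[of h \<epsilon> hr, OF assms(1,2)]
  have "(\<exists>\<delta>>0. \<forall>t. 0 < t \<and> t < \<delta> \<longrightarrow> hr t = 0) \<or>
    (\<exists>P n c q \<delta>. 0 < \<delta> \<and> P holomorphic_on ball 0 \<delta> \<and> P 0 = complex_of_real c \<and> c \<noteq> 0 \<and>
       (\<forall>t. 0 < t \<and> t < \<delta> \<longrightarrow> P (of_real t) = of_real (q t) \<and> hr t = q t * t powi n \<and> 0 < q t * c))"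
    by (rule factor) (rule assms(3))
  then show ?thesis
  proof (elim disjE exE conjE)
    fix \<delta> :: real assume "0 < \<delta>" "\<forall>t. 0 < t \<and> t < \<delta> \<longrightarrow> hr t = 0"
    then show ?thesis by (intro exI[of _ \<delta>]) simp
  next
    fix P :: "complex \<Rightarrow> complex" and n c q \<delta>
    assume *: "0 < \<delta>" "c \<noteq> 0" "\<forall>t. 0 < t \<and> t < \<delta> \<longrightarrow>
        P (of_real t) = of_real (q t) \<and> hr t = q t * t powi n \<and> 0 < q t * c"
    have "0 < hr t * c" if "0 < t" "t < \<delta>" for t
    proof -
      have "hr t = q t * t powi n" "0 < q t * c" using *(3) that by blast+
      moreover have "0 < t powi n" using that(1) by simp
      ultimately have "hr t * c = (q t * c) * t powi n" "0 < (q t * c) * t powi n"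
        by (simp_all only: mult_pos_pos) (simp add: ac_simps)
      then show ?thesis by (simp only:)
    qed
    then have "(\<forall>t. 0 < t \<and> t < \<delta> \<longrightarrow> 0 < hr t) \<or> (\<forall>t. 0 < t \<and> t < \<delta> \<longrightarrow> hr t < 0)"
      using \<open>c \<noteq> 0\<close> by (cases "c > 0") (auto simp: zero_less_mult_iff)
    then show ?thesis using *(1) by (intro exI[of _ \<delta>]) simp
  qed
qed

text \<open>With \<open>h(t) = t\<^sup>n P(t)\<close> and \<open>P(0) > 0\<close>, the square root of \<open>h(s\<^sup>2)\<close> is \<open>s\<^sup>n\<close> times that of \<open>P(s\<^sup>2)\<close>; the
  substitution \<open>t = s\<^sup>2\<close> is what removes the branching for odd \<open>n\<close>.\<close>

lemma real_meromorphic_sqrt: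
  assumes "h meromorphic_on {0}" and "0 < \<epsilon>"
    and "\<And>t. 0 < t \<Longrightarrow> t < \<epsilon> \<Longrightarrow> h (of_real t) = of_real (hr t)"
    and pos: "\<And>t. 0 < t \<Longrightarrow> t < \<epsilon> \<Longrightarrow> 0 < hr t"
  shows "\<exists>g \<delta>. g meromorphic_on {0} \<and> 0 < \<delta> \<and>
    (\<forall>s. 0 < s \<and> s < \<delta> \<longrightarrow> g (of_real s) = of_real (sqrt (hr (s\<^sup>2))))"
proof -
  note factor = real_meromorphic_factor[of h \<epsilon> hr, OF assms(1,2)]
  have "(\<exists>\<delta>>0. \<forall>t. 0 < t \<and> t < \<delta> \<longrightarrow> hr t = 0) \<or>
    (\<exists>P n c q \<delta>. 0 < \<delta> \<and> P holomorphic_on ball 0 \<delta> \<and> P 0 = complex_of_real c \<and> c \<noteq> 0 \<and>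
       (\<forall>t. 0 < t \<and> t < \<delta> \<longrightarrow> P (of_real t) = of_real (q t) \<and> hr t = q t * t powi n \<and> 0 < q t * c))"
    by (rule factor) (rule assms(3))
  then show ?thesis
  proof (elim disjE exE conjE)
    fix \<delta> :: real assume *: "0 < \<delta>" "\<forall>t. 0 < t \<and> t < \<delta> \<longrightarrow> hr t = 0"
    define t where "t = min \<delta> \<epsilon> / 2"
    have "0 < t" "t < \<delta>" "t < \<epsilon>" using *(1) assms(2) by (auto simp: t_def)
    then have False using pos[of t] *(2) by simp
    then show ?thesis ..
  next
    fix P :: "complex \<Rightarrow> complex" and n c q \<delta>
    assume *: "0 < \<delta>" "P holomorphic_on ball 0 \<delta>" "P 0 = of_real c" "c \<noteq> 0" "\<forall>t. 0 < t \<and> t < \<delta> \<longrightarrow>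
        P (of_real t) = of_real (q t) \<and> hr t = q t * t powi n \<and> 0 < q t * c"
    have q: "0 < q t" if "0 < t" "t < \<delta>" "t < \<epsilon>" for t
    proof -
      have "0 < q t * t powi n" using pos[of t] *(5) that by metis
      moreover have "0 < t powi n" using that(1) by simp
      ultimately show ?thesis by (rule zero_less_mult_pos2)
    qed
    have "0 < c"
    proof -
      define t where "t = min \<delta> \<epsilon> / 2"
      have t: "0 < t" "t < \<delta>" "t < \<epsilon>" using *(1) assms(2) by (auto simp: t_def)
      have "0 < q t * c" using *(5) t by blast
      then show ?thesis using q[OF t] by (simp add: zero_less_mult_iff)
    qed
    then have "P 0 \<in> - \<real>\<^sub>\<le>\<^sub>0" using *(3) by simp
    moreover have "isCont P 0"
      using holomorphic_on_imp_continuous_on[OF *(2)] *(1) by (simp add: continuous_on_eq_continuous_at)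
    moreover have "open (- \<real>\<^sub>\<le>\<^sub>0 :: complex set)" by (simp add: closed_nonpos_Reals_complex open_Compl)
    ultimately have "\<forall>\<^sub>F w in nhds 0. P w \<in> - \<real>\<^sub>\<le>\<^sub>0"
      by (metis isContD tendsto_at_iff_tendsto_nhds topological_tendstoD)
    then obtain d where d: "d > 0" "\<And>w. dist w 0 < d \<Longrightarrow> P w \<in> - \<real>\<^sub>\<le>\<^sub>0"
      unfolding eventually_nhds_metric by auto
    define \<eta> where "\<eta> = min (min 1 \<epsilon>) (min d \<delta>)"
    have \<eta>: "0 < \<eta>" "\<eta> \<le> 1" "\<eta> \<le> \<epsilon>" "\<eta> \<le> d" "\<eta> \<le> \<delta>" using *(1) assms(2) d(1) by (auto simp: \<eta>_def)
    have sq: "s\<^sup>2 < \<eta>" if "0 < s" "s < \<eta>" for s :: real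
    proof -
      have "s * s < \<eta> * 1" using that \<eta> by (intro mult_strict_mono) auto
      then show ?thesis by (simp add: power2_eq_square)
    qed
    have sqball: "z\<^sup>2 \<in> ball 0 \<eta>" if "z \<in> ball 0 \<eta>" for z :: complex
    proof (cases "z = 0")
      case False
      then show ?thesis using sq[of "norm z"] that by (simp add: norm_power)
    qed (use \<eta> in simp)
    have "(P \<circ> (\<lambda>z. z\<^sup>2)) holomorphic_on ball 0 \<eta>"
    proof (rule holomorphic_on_compose_gen[OF _ *(2)])
      show "(\<lambda>z. z\<^sup>2) ` ball 0 \<eta> \<subseteq> ball (0::complex) \<delta>"
        using sqball \<eta>(5) by fastforce
    qed (intro holomorphic_intros)
    then have "(\<lambda>z. csqrt ((P \<circ> (\<lambda>z. z\<^sup>2)) z)) holomorphic_on ball 0 \<eta>"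
    proof (rule holomorphic_on_csqrt')
      fix z :: complex assume "z \<in> ball 0 \<eta>"
      then have "dist (z\<^sup>2) 0 < d" using sqball[of z] \<eta>(4) by (simp add: dist_commute)
      then show "(P \<circ> (\<lambda>z. z\<^sup>2)) z \<notin> \<real>\<^sub>\<le>\<^sub>0" using d(2) by simp
    qed
    then have ana: "(\<lambda>z. csqrt (P (z\<^sup>2))) analytic_on {0}"
      unfolding analytic_at using \<eta>(1) by (intro exI[of _ "ball 0 \<eta>"]) (simp add: o_def)
    define g where "g = (\<lambda>z. z powi n * csqrt (P (z\<^sup>2)))"
    have "g meromorphic_on {0}"
      unfolding g_def by (intro meromorphic_intros analytic_on_imp_meromorphic_on ana)
    moreover have "g (of_real s) = of_real (sqrt (hr (s\<^sup>2)))" if s: "0 < s \<and> s < \<eta>" for s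
    proof -
      have s2: "0 < s\<^sup>2" "s\<^sup>2 < \<delta>" "s\<^sup>2 < \<epsilon>" using s sq[of s] \<eta> by auto
      have Ps: "P (of_real (s\<^sup>2)) = of_real (q (s\<^sup>2))" and hs: "hr (s\<^sup>2) = q (s\<^sup>2) * (s\<^sup>2) powi n"
        using *(5) s2 by blast+
      have "(s\<^sup>2) powi n = (s powi n)\<^sup>2"
        by (simp add: power2_eq_square power_int_mult_distrib)
      then have "sqrt (hr (s\<^sup>2)) = sqrt (q (s\<^sup>2)) * (s powi n)"
        unfolding hs using s by (simp add: real_sqrt_mult)
      moreover have "csqrt (P (of_real (s\<^sup>2))) = of_real (sqrt (q (s\<^sup>2)))"
        unfolding Ps using q[OF s2] by simp
      ultimately show ?thesis unfolding g_def by (simp add: mult.commute)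
    qed
    ultimately show ?thesis using \<eta>(1) by (intro exI[of _ g] exI[of _ \<eta>]) simp
  qed
qed

lemma poly_map_poly_of_real:
  "poly (map_poly complex_of_real p) (of_real x) = of_real (poly p x)"
  by (induction p) (simp_all add: map_poly_pCons)

lemma meromorphic_on_poly:
  assumes "f meromorphic_on A"
  shows "(\<lambda>z. poly p (f z)) meromorphic_on A"
  by (induction p) (auto intro!: meromorphic_intros assms)

section \<open>Stereographic projection\<close>

text \<open>Inverse stereographic projection from \<open>p\<close>, where \<open>e\<close> and \<open>w\<close> span the plane orthogonal to \<open>p\<close>.\<close>

definition stereo :: "real ^ 3 \<Rightarrow> real ^ 3 \<Rightarrow> real ^ 3 \<Rightarrow> real \<Rightarrow> real \<Rightarrow> real ^ 3" where
  "stereo e w p u v = p + (2 / (1 + u\<^sup>2 + v\<^sup>2)) *\<^sub>R (u *\<^sub>R e + v *\<^sub>R w - p)"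

lemma stereo_denom: "0 < 1 + u\<^sup>2 + (v::real)\<^sup>2"
  by (smt (verit) zero_le_power2)

lemma stereo_coords:
  assumes "frame e w p"
  shows "stereo e w p u v \<bullet> e = 2 * u / (1 + u\<^sup>2 + v\<^sup>2)"
    "stereo e w p u v \<bullet> w = 2 * v / (1 + u\<^sup>2 + v\<^sup>2)"
    "stereo e w p u v \<bullet> p = 1 - 2 / (1 + u\<^sup>2 + v\<^sup>2)"
  using assms unfolding stereo_def frame_def
  by (simp_all add: inner_add_left inner_diff_left inner_commute algebra_simps diff_divide_distrib add_divide_distrib)

lemma stereo_uv:
  assumes "frame e w p"
  shows "u = (stereo e w p u v \<bullet> e) / (1 - stereo e w p u v \<bullet> p)"
    "v = (stereo e w p u v \<bullet> w) / (1 - stereo e w p u v \<bullet> p)"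
  using stereo_denom[of u v] unfolding stereo_coords[OF assms] by (simp_all add: field_simps)

lemma stereo_inj:
  assumes "frame e w p" "stereo e w p u v = stereo e w p u' v'"
  shows "u = u' \<and> v = v'"
  using stereo_uv(1)[OF assms(1), of u v] stereo_uv(2)[OF assms(1), of v u]
    stereo_uv(1)[OF assms(1), of u' v'] stereo_uv(2)[OF assms(1), of v' u']
  unfolding assms(2) by simp

lemma stereo_in_S2:
  assumes "frame e w p"
  shows "stereo e w p u v \<in> S2"
proof -
  define k where "k = 2 / (1 + u\<^sup>2 + v\<^sup>2)"
  have k: "k * (1 + u\<^sup>2 + v\<^sup>2) = 2"
    using stereo_denom[of u v] nonzero_eq_divide_eq[of "1 + u\<^sup>2 + v\<^sup>2" k 2] k_def by simp
  have "stereo e w p u v = (k * u) *\<^sub>R e + (k * v) *\<^sub>R w + (1 - k) *\<^sub>R p"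
    unfolding stereo_def k_def[symmetric] by (simp add: algebra_simps)
  then have "stereo e w p u v \<bullet> stereo e w p u v = (k * u) * (k * u) + (k * v) * (k * v) + (1 - k) * (1 - k)"
    using frame_inner[OF assms] by simp
  also have "\<dots> = k * (k * (1 + u\<^sup>2 + v\<^sup>2)) - 2 * k + 1"
    by (simp add: power2_eq_square algebra_simps)
  finally show ?thesis unfolding k by (simp add: norm_eq_1)
qed

lemma stereo_surj:
  assumes fr: "frame e w p" and x: "x \<in> S2" "x \<noteq> p"
  shows "x = stereo e w p ((x \<bullet> e) / (1 - x \<bullet> p)) ((x \<bullet> w) / (1 - x \<bullet> p))"
proof -
  define a b c where "a = x \<bullet> e" and "b = x \<bullet> w" and "c = x \<bullet> p"
  have xe: "x = a *\<^sub>R e + b *\<^sub>R w + c *\<^sub>R p"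
    unfolding a_def b_def c_def by (rule frame_expand[OF fr])
  have "x \<bullet> x = 1" using x(1) by (simp add: norm_eq_1)
  then have abc: "a * a + b * b + c * c = 1"
    using frame_inner[OF fr, of a b c a b c] xe by simp
  have c1: "c \<noteq> 1"
  proof
    assume "c = 1"
    then have "a * a + b * b = 0" using abc by simp
    then have "a = 0" "b = 0" by (simp_all add: sum_squares_eq_zero_iff)
    then show False using xe x(2) \<open>c = 1\<close> by simp
  qed
  define k where "k = 1 - c"
  have k: "k \<noteq> 0" using c1 by (simp add: k_def)
  have "a\<^sup>2 + b\<^sup>2 + k\<^sup>2 = 2 * k" using abc by (simp add: k_def power2_eq_square algebra_simps)
  then have D: "1 + (a / k)\<^sup>2 + (b / k)\<^sup>2 = 2 / k"
    using k by (simp add: power_divide field_simps power2_eq_square)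
  have "stereo e w p (a / k) (b / k) = p + k *\<^sub>R ((a / k) *\<^sub>R e + (b / k) *\<^sub>R w - p)"
    unfolding stereo_def D using k by simp
  also have "\<dots> = p + (a *\<^sub>R e + b *\<^sub>R w - k *\<^sub>R p)"
    using k by (simp add: scaleR_add_right scaleR_diff_right)
  also have "\<dots> = a *\<^sub>R e + b *\<^sub>R w + c *\<^sub>R p" by (simp add: k_def algebra_simps)
  also have "\<dots> = x" by (rule xe[symmetric])
  finally show ?thesis unfolding a_def b_def k_def c_def by simp
qed

section \<open>Arcs over one-sided neighbourhoods\<close>

text \<open>Up to finitely many points of \<open>V\<close>, the set \<open>W\<close> is a finite union of arcs. The exceptional points need
  not lie in \<open>W\<close>: the arcs are compact, and their end points may belong to the closure of \<open>W\<close> only.\<close>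

definition covered :: "(real ^ 3) set \<Rightarrow> (real ^ 3) set \<Rightarrow> bool" where
  "covered V W \<longleftrightarrow> (\<exists>F E. arc_family F \<and> finite E \<and> E \<subseteq> V \<and> \<Union>F \<subseteq> W \<union> E \<and> W \<subseteq> \<Union>F \<union> E)"

lemma coveredI:
  assumes "arc_family F" "finite E" "E \<subseteq> V" "\<Union>F \<subseteq> W \<union> E" "W \<subseteq> \<Union>F \<union> E"
  shows "covered V W"
  unfolding covered_def by (rule exI[of _ F], rule exI[of _ E]) (intro conjI assms)

lemma arc_family_empty: "arc_family {}"
  by (simp add: arc_family_def)

lemma covered_finite:
  assumes "finite W" "W \<subseteq> V"
  shows "covered V W"
  by (rule coveredI[OF arc_family_empty assms]) auto

lemma covered_Un:
  assumes "covered V W" "covered V W'" "W \<inter> W' = {}"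
  shows "covered V (W \<union> W')"
proof -
  obtain F E where F: "arc_family F" "finite E" "E \<subseteq> V" "\<Union>F \<subseteq> W \<union> E" "W \<subseteq> \<Union>F \<union> E"
    using assms(1) unfolding covered_def by (elim exE conjE) (rule that)
  obtain F' E' where F': "arc_family F'" "finite E'" "E' \<subseteq> V" "\<Union>F' \<subseteq> W' \<union> E'" "W' \<subseteq> \<Union>F' \<union> E'"
    using assms(2) unfolding covered_def by (elim exE conjE) (rule that)
  have fin: "finite (C \<inter> C')" if "C \<in> F" "C' \<in> F'" for C C'
  proof (rule finite_subset)
    have "C \<subseteq> W \<union> E" "C' \<subseteq> W' \<union> E'" using that F(4) F'(4) by auto
    then show "C \<inter> C' \<subseteq> E \<union> E'" using assms(3) by auto
    show "finite (E \<union> E')" using F(2) F'(2) by simp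
  qed
  have "arc_family (F \<union> F')" using F(1) F'(1) fin by (intro arc_family_Un)
  then show ?thesis
  proof (rule coveredI)
    show "finite (E \<union> E')" using F(2) F'(2) by simp
    show "E \<union> E' \<subseteq> V" using F(3) F'(3) by auto
    show "\<Union>(F \<union> F') \<subseteq> W \<union> W' \<union> (E \<union> E')" using F(4) F'(4) by auto
    show "W \<union> W' \<subseteq> \<Union>(F \<union> F') \<union> (E \<union> E')" using F(5) F'(5) by auto
  qed
qed

text \<open>The coordinates of the point on the sphere are meromorphic functions of \<open>s\<close> that are bounded by one for
  real \<open>s\<close>, even if \<open>u\<close> or \<open>v\<close> has a pole at \<open>0\<close>. So they extend holomorphically to a disc around \<open>0\<close>. As \<open>V\<close> is
  closed, the end point at \<open>s = 0\<close> stays in \<open>V\<close>.\<close>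

lemma stereo_arc_covered:
  assumes fr: "frame e w p"
    and uc: "uc meromorphic_on {0}" and vc: "vc meromorphic_on {0}" and \<epsilon>: "0 < \<epsilon>"
    and u: "\<And>s. 0 < s \<Longrightarrow> s < \<epsilon> \<Longrightarrow> uc (of_real s) = of_real (u s)"
    and v: "\<And>s. 0 < s \<Longrightarrow> s < \<epsilon> \<Longrightarrow> vc (of_real s) = of_real (v s)"
    and inj: "inj_on u {0<..<\<epsilon>}"
    and V: "closed V" "V \<subseteq> S2" "\<And>s. 0 < s \<Longrightarrow> s < \<epsilon> \<Longrightarrow> stereo e w p (u s) (v s) \<in> V"
  shows "\<exists>\<delta>>0. \<delta> \<le> \<epsilon> \<and> (\<forall>s1. 0 < s1 \<and> s1 < \<delta> \<longrightarrow>
     covered V ((\<lambda>s. stereo e w p (u s) (v s)) ` {0<..<s1}))"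
proof -
  define X where "X s = stereo e w p (u s) (v s)" for s
  define f :: "3 \<Rightarrow> complex \<Rightarrow> complex" where "f i z = of_real (p $ i) + 2 / (1 + (uc z)\<^sup>2 + (vc z)\<^sup>2)
     * (uc z * of_real (e $ i) + vc z * of_real (w $ i) - of_real (p $ i))" for i z
  have f_mero: "f i meromorphic_on {0}" for i
    unfolding f_def by (intro meromorphic_intros uc vc)
  have f_real: "f i (of_real s) = of_real (X s $ i)" if "0 < s" "s < \<epsilon>" for i s
    unfolding f_def u[OF that] v[OF that] X_def stereo_def by simp
  have f_bd: "norm (f i (of_real s)) \<le> 1" if "0 < s" "s < \<epsilon>" for i s
  proof -
    have "norm (X s) = 1" using stereo_in_S2[OF fr] unfolding X_def by simp
    then have "\<bar>X s $ i\<bar> \<le> 1" using component_le_norm_cart[of "X s" i] by simp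
    then show ?thesis unfolding f_real[OF that] by simp
  qed
  have "\<forall>i. \<exists>d. 0 < d \<and> (\<exists>F. F holomorphic_on ball 0 d \<and> (\<forall>s. 0 < s \<and> s < d \<longrightarrow> F (of_real s) = f i (of_real s)))"
    using meromorphic_bounded_extension[OF f_mero \<epsilon> f_bd] by simp
  then obtain d where d: "\<forall>i. 0 < d i \<and> (\<exists>F. F holomorphic_on ball 0 (d i) \<and>
      (\<forall>s. 0 < s \<and> s < d i \<longrightarrow> F (of_real s) = f i (of_real s)))"
    by (rule choice[THEN exE])
  then have "\<forall>i. \<exists>F. F holomorphic_on ball 0 (d i) \<and>
      (\<forall>s. 0 < s \<and> s < d i \<longrightarrow> F (of_real s) = f i (of_real s))" by simp
  then obtain F where F: "\<forall>i. F i holomorphic_on ball 0 (d i) \<and>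
      (\<forall>s. 0 < s \<and> s < d i \<longrightarrow> F i (of_real s) = f i (of_real s))"
    by (rule choice[THEN exE])
  define \<delta> where "\<delta> = min \<epsilon> (Min (range d))"
  have \<delta>: "0 < \<delta>" "\<delta> \<le> \<epsilon>" "\<And>i. \<delta> \<le> d i" using d \<epsilon> by (auto simp: \<delta>_def intro: min.coboundedI2)
  have F_hol: "F i holomorphic_on ball 0 \<delta>" for i
  proof (rule holomorphic_on_subset)
    show "F i holomorphic_on ball 0 (d i)" using F by blast
    show "ball 0 \<delta> \<subseteq> (ball 0 (d i) :: complex set)" using \<delta>(3)[of i] by (rule subset_ball)
  qed
  have F_real: "F i (of_real s) = of_real (X s $ i)" if s: "0 < s" "s < \<delta>" for i s
  proof -
    have "s < d i" "s < \<epsilon>" using s \<delta>(2) \<delta>(3)[of i] by auto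
    then show ?thesis using F f_real[of s i] s(1) by metis
  qed
  have lim: "((\<lambda>s. F i (of_real s)) \<longlongrightarrow> F i 0) (at_right 0)" for i
  proof -
    have "isCont (F i) 0"
      using holomorphic_on_imp_continuous_on[OF F_hol] \<delta>(1) by (simp add: continuous_on_eq_continuous_at)
    moreover have "(complex_of_real \<longlongrightarrow> 0) (at_right 0)" by (auto intro!: tendsto_eq_intros)
    ultimately show ?thesis by (rule isCont_tendsto_compose)
  qed
  have ev: "\<forall>\<^sub>F s in at_right 0. 0 < s \<and> s < \<delta>"
    unfolding eventually_at_right_field using \<delta>(1) by (intro exI[of _ \<delta>]) simp
  have F0: "F i 0 \<in> \<real>" for i
  proof (rule Lim_in_closed_set[OF closed_complex_Reals _ _ lim])
    show "\<forall>\<^sub>F s in at_right 0. F i (of_real s) \<in> \<real>"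
      using ev by eventually_elim (simp add: F_real)
  qed simp
  define g :: "real \<Rightarrow> real ^ 3" where "g t = (\<chi> i. Re (F i (of_real t)))" for t
  have gX: "g s = X s" if "0 < s" "s < \<delta>" for s
    unfolding g_def using F_real[OF that] by (simp add: vec_eq_iff)
  have "(g \<longlongrightarrow> g 0) (at_right 0)"
    unfolding g_def by (intro tendsto_vec_lambda tendsto_Re) (use lim in simp)
  then have g0: "g 0 \<in> V"
  proof (rule Lim_in_closed_set[OF V(1), rotated 2])
    show "\<forall>\<^sub>F s in at_right 0. g s \<in> V"
      using ev
    proof eventually_elim
      case (elim s)
      then have "X s \<in> V" unfolding X_def using V(3) \<delta>(2) by auto
      then show "g s \<in> V" using gX[of s] elim by simp
    qed
  qed simp
  have main: "covered V (X ` {0<..<s1})" if s1: "0 < s1" "s1 < \<delta>" for s1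
  proof -
    define C where "C = g ` {0..s1}"
    have XV: "X s \<in> V" if "0 < s" "s < \<delta>" for s unfolding X_def using V(3) that \<delta>(2) by auto
    have CV: "C \<subseteq> V"
    proof
      fix x assume "x \<in> C"
      then obtain s where s: "0 \<le> s" "s \<le> s1" "x = g s" by (auto simp: C_def)
      show "x \<in> V"
      proof (cases "s = 0")
        case False
        then have "0 < s" "s < \<delta>" using s s1 by auto
        then show ?thesis using gX XV s(3) by simp
      qed (use g0 s in simp)
    qed
    have inf: "infinite C"
    proof -
      have "inj_on X {0<..<s1}"
      proof (rule inj_onI)
        fix s t assume st: "s \<in> {0<..<s1}" "t \<in> {0<..<s1}" "X s = X t"
        have "u s = u t" using stereo_inj[OF fr st(3)[unfolded X_def]] by simp
        moreover have "s \<in> {0<..<\<epsilon>}" "t \<in> {0<..<\<epsilon>}" using st(1,2) s1 \<delta>(2) by auto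
        ultimately show "s = t" using inj by (simp add: inj_on_eq_iff)
      qed
      moreover have "infinite {0<..<s1}" using s1(1) by simp
      ultimately have "infinite (X ` {0<..<s1})" by (simp add: finite_image_iff)
      moreover have "X ` {0<..<s1} \<subseteq> C"
      proof
        fix x assume "x \<in> X ` {0<..<s1}"
        then obtain s where s: "0 < s" "s < s1" "x = X s" by auto
        then have "x = g s" using gX s1(2) by simp
        then show "x \<in> C" using s unfolding C_def by auto
      qed
      ultimately show ?thesis by (metis finite_subset)
    qed
    have "holo_arc C"
      unfolding holo_arc_def
    proof (rule conjI[OF inf], rule exI[of _ F], rule exI[of _ "ball 0 \<delta>"], rule exI[of _ 0],
        rule exI[of _ s1], intro conjI allI ballI)
      show "complex_of_real ` {0..s1} \<subseteq> ball 0 \<delta>" using s1 by auto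
      show "F i holomorphic_on ball 0 \<delta>" for i by (rule F_hol)
      show "F i (complex_of_real t) \<in> \<real>" if "t \<in> {0..s1}" for i t
        using that s1 F0[of i] F_real[of t i] by (cases "t = 0") auto
      show "C = (\<lambda>t. \<chi> i. Re (F i (of_real t))) ` {0..s1}" unfolding C_def g_def ..
    qed (use s1 in auto)
    then have "arc_family {C}" unfolding arc_family_def using CV V(2) by (auto simp: pairwise_def)
    then show ?thesis
    proof (rule coveredI)
      show "finite {g 0, g s1}" by simp
      show "{g 0, g s1} \<subseteq> V" using CV s1 unfolding C_def by auto
      show "\<Union>{C} \<subseteq> X ` {0<..<s1} \<union> {g 0, g s1}"
      proof
        fix x assume "x \<in> \<Union>{C}"
        then obtain s where s: "0 \<le> s" "s \<le> s1" "x = g s" by (auto simp: C_def)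
        then consider "s = 0" | "s = s1" | "0 < s" "s < s1" by linarith
        then show "x \<in> X ` {0<..<s1} \<union> {g 0, g s1}"
        proof cases
          case 3
          then show ?thesis using s(3) gX[of s] s1 by auto
        qed (use s in auto)
      qed
      show "X ` {0<..<s1} \<subseteq> \<Union>{C} \<union> {g 0, g s1}"
      proof
        fix x assume "x \<in> X ` {0<..<s1}"
        then obtain s where s: "0 < s" "s < s1" "x = X s" by auto
        then have "x = g s" using gX s1(2) by simp
        then show "x \<in> \<Union>{C} \<union> {g 0, g s1}" using s unfolding C_def by auto
      qed
    qed
  qed
  show ?thesis using \<delta>(1,2) main unfolding X_def by (intro exI[of _ \<delta>]) simp
qed

section \<open>Gluing along the projection\<close>

text \<open>All that the covering argument uses of a quadric: degree two in \<open>v\<close> for the quadratic formula, and closedness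
  for the end points of the arcs.\<close>

locale stereo_curve =
  fixes e w p :: "real ^ 3" and V :: "(real ^ 3) set" and A B C :: "real poly"
  assumes fr: "frame e w p" and V: "closed V" "V \<subseteq> S2" "p \<in> V"
    and mem: "\<And>u v. stereo e w p u v \<in> V \<longleftrightarrow> poly A u * v\<^sup>2 + poly B u * v + poly C u = 0"
    and nonzero: "\<not> (A = 0 \<and> B = 0 \<and> C = 0)"
begin

definition over :: "real set \<Rightarrow> (real ^ 3) set" where
  "over T = {x. \<exists>u v. x = stereo e w p u v \<and> u \<in> T \<and> x \<in> V}"

lemma over_Un: "over (T \<union> T') = over T \<union> over T'"
  unfolding over_def by blast

lemma over_disjoint: "T \<inter> T' = {} \<Longrightarrow> over T \<inter> over T' = {}"
  unfolding over_def using stereo_inj[OF fr] by blast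

lemma covered_over_Un:
  assumes "covered V (over T)" "covered V (over T')" "T \<inter> T' = {}"
  shows "covered V (over (T \<union> T'))"
  unfolding over_Un by (rule covered_Un[OF assms(1,2) over_disjoint[OF assms(3)]])

lemma covered_over_empty: "covered V (over {})"
  by (rule covered_finite) (auto simp: over_def)

text \<open>If the three coefficients vanish at \<open>u\<close>, the fibre is a full line, whose image on the sphere is a circle through
  \<open>p\<close>; otherwise the fibre is finite.\<close>

lemma covered_over_point: "covered V (over {u})"
proof (cases "poly A u = 0 \<and> poly B u = 0 \<and> poly C u = 0")
  case True
  have all: "stereo e w p u v \<in> V" for v using True mem by simp
  define c where "c = sqrt (1 + u\<^sup>2)"
  have c: "c > 0" "c\<^sup>2 = 1 + u\<^sup>2" unfolding c_def by (simp_all add: add_pos_nonneg)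
  define n where "n = (1 / c) *\<^sub>R (e + u *\<^sub>R p)"
  define K where "K = {x \<in> S2. n \<bullet> x = u / c}"
  have nn: "n \<bullet> n = 1"
  proof -
    have "(e + u *\<^sub>R p) \<bullet> (e + u *\<^sub>R p) = 1 + u\<^sup>2"
      using frame_inner[OF fr, of 1 0 u 1 0 u] by (simp add: power2_eq_square)
    then have "n \<bullet> n = (1 + u\<^sup>2) / c\<^sup>2" unfolding n_def by (simp add: power2_eq_square)
    moreover have "0 < 1 + u\<^sup>2" by (simp add: add_pos_nonneg)
    ultimately show ?thesis using c(2) by simp
  qed
  have "\<bar>u\<bar> < c" unfolding c_def by (rule real_less_rsqrt) (simp add: power2_eq_square)
  then have "\<bar>u / c\<bar> < 1" using c(1) by simp
  then have arc: "holo_arc K" unfolding K_def by (rule holo_arc_circle[OF nn])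
  have n_inner: "n \<bullet> x = u / c \<longleftrightarrow> x \<bullet> e + u * (x \<bullet> p) = u" for x
    using c(1) unfolding n_def by (simp add: inner_commute inner_add_right field_simps)
  have n_stereo: "n \<bullet> stereo e w p u' v = u / c \<longleftrightarrow> u' = u" for u' v
  proof -
    define D where "D = 1 + u'\<^sup>2 + v\<^sup>2"
    have "D > 0" unfolding D_def by (rule stereo_denom)
    then show ?thesis
      unfolding n_inner stereo_coords[OF fr] D_def[symmetric] by (simp add: field_simps)
  qed
  have "arc_family {K}" unfolding arc_family_def using arc by (auto simp: pairwise_def K_def)
  then show ?thesis
  proof (rule coveredI)
    show "{p} \<subseteq> V" using V(3) by simp
    show "\<Union>{K} \<subseteq> over {u} \<union> {p}"
    proof
      fix x assume "x \<in> \<Union>{K}"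
      then have x: "x \<in> S2" "n \<bullet> x = u / c" by (auto simp: K_def)
      show "x \<in> over {u} \<union> {p}"
      proof (cases "x = p")
        case False
        obtain u' v where xs: "x = stereo e w p u' v" using stereo_surj[OF fr x(1) False] by blast
        then have "u' = u" using n_stereo x(2) by simp
        then show ?thesis using xs all unfolding over_def by blast
      qed simp
    qed
    show "over {u} \<subseteq> \<Union>{K} \<union> {p}"
    proof
      fix x assume "x \<in> over {u}"
      then obtain v where "x = stereo e w p u v" unfolding over_def by blast
      then show "x \<in> \<Union>{K} \<union> {p}" using n_stereo stereo_in_S2[OF fr] unfolding K_def by simp
    qed
  qed simp
next
  case False
  define P where "P = [:poly C u, poly B u, poly A u:]"
  have "P \<noteq> 0" using False by (auto simp: P_def)
  then have "finite {v. poly P v = 0}" by (rule poly_roots_finite)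
  then have "finite (stereo e w p u ` {v. poly P v = 0})" by (rule finite_imageI)
  moreover have "over {u} \<subseteq> stereo e w p u ` {v. poly P v = 0}"
  proof
    fix x assume "x \<in> over {u}"
    then obtain v where x: "x = stereo e w p u v" "x \<in> V" unfolding over_def by blast
    then have "poly P v = 0" using mem[of u v] by (simp add: P_def power2_eq_square algebra_simps)
    then show "x \<in> stereo e w p u ` {v. poly P v = 0}" using x(1) by blast
  qed
  ultimately have "finite (over {u})" by (rule finite_subset[rotated])
  then show ?thesis by (rule covered_finite) (auto simp: over_def)
qed

text \<open>Here \<open>U\<close> maps small \<open>t > 0\<close> to a one-sided neighbourhood of a point of the \<open>u\<close>-line or of infinity. Close
  to \<open>t = 0\<close>, the polynomials \<open>A\<close>, \<open>B\<close>, \<open>C\<close> and the discriminant either vanish identically or have no zero, so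
  that the number of solutions \<open>v\<close> is constant, and they depend meromorphically on \<open>s\<close>, where \<open>t = s\<^sup>2\<close>.\<close>

lemma side_covered:
  assumes Uc: "Uc meromorphic_on {0}" and Uc2: "(\<lambda>z. Uc (z\<^sup>2)) meromorphic_on {0}"
    and U: "\<And>t. 0 < t \<Longrightarrow> Uc (of_real t) = of_real (U t)" and inj: "inj_on U {0<..}"
  shows "\<exists>\<delta>>0. \<forall>s1. 0 < s1 \<and> s1 < \<delta> \<longrightarrow> covered V (over ((\<lambda>s. U (s\<^sup>2)) ` {0<..<s1}))"
proof -
  define m :: "real poly \<Rightarrow> complex poly" where "m = map_poly of_real"
  have m: "poly (m D) (Uc (of_real t)) = of_real (poly D (U t))" if "0 < t" for D t
    unfolding U[OF that] m_def by (rule poly_map_poly_of_real)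
  have sgn: "\<exists>\<delta>>0. (\<forall>t. 0 < t \<and> t < \<delta> \<longrightarrow> poly D (U t) = 0) \<or> (\<forall>t. 0 < t \<and> t < \<delta> \<longrightarrow> 0 < poly D (U t)) \<or>
      (\<forall>t. 0 < t \<and> t < \<delta> \<longrightarrow> poly D (U t) < 0)" for D
    by (rule real_meromorphic_sign[where h = "\<lambda>z. poly (m D) (Uc z)" and \<epsilon> = 1])
      (simp_all add: m meromorphic_on_poly[OF Uc])
  have zero_or_nonzero: "\<exists>\<delta>>0. (\<forall>t. 0 < t \<and> t < \<delta> \<longrightarrow> poly D (U t) = 0) \<or>
      (\<forall>t. 0 < t \<and> t < \<delta> \<longrightarrow> poly D (U t) \<noteq> 0)" for D
    using sgn[of D] by (metis less_irrefl)
  define \<Delta> where "\<Delta> = B\<^sup>2 - 4 * A * C"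
  have poly_\<Delta>: "poly \<Delta> u = (poly B u)\<^sup>2 - 4 * poly A u * poly C u" for u
    by (simp add: \<Delta>_def)
  obtain dA where dA: "dA > 0" "(\<forall>t. 0 < t \<and> t < dA \<longrightarrow> poly A (U t) = 0) \<or>
      (\<forall>t. 0 < t \<and> t < dA \<longrightarrow> poly A (U t) \<noteq> 0)"
    using zero_or_nonzero[of A] by (elim exE conjE) (rule that)
  obtain dB where dB: "dB > 0" "(\<forall>t. 0 < t \<and> t < dB \<longrightarrow> poly B (U t) = 0) \<or>
      (\<forall>t. 0 < t \<and> t < dB \<longrightarrow> poly B (U t) \<noteq> 0)"
    using zero_or_nonzero[of B] by (elim exE conjE) (rule that)
  obtain dC where dC: "dC > 0" "(\<forall>t. 0 < t \<and> t < dC \<longrightarrow> poly C (U t) = 0) \<or>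
      (\<forall>t. 0 < t \<and> t < dC \<longrightarrow> poly C (U t) \<noteq> 0)"
    using zero_or_nonzero[of C] by (elim exE conjE) (rule that)
  obtain dD where dD: "dD > 0" "(\<forall>t. 0 < t \<and> t < dD \<longrightarrow> poly \<Delta> (U t) = 0) \<or>
      (\<forall>t. 0 < t \<and> t < dD \<longrightarrow> 0 < poly \<Delta> (U t)) \<or> (\<forall>t. 0 < t \<and> t < dD \<longrightarrow> poly \<Delta> (U t) < 0)"
    using sgn[of \<Delta>] by (elim exE conjE) (rule that)
  \<comment> \<open>the square root of the discriminant, in case it is positive; \<open>\<eta>\<close> has to be known before \<open>\<epsilon>\<close> is chosen\<close>
  have "\<exists>g \<eta>. 0 < \<eta> \<and> ((\<forall>t. 0 < t \<and> t < dD \<longrightarrow> 0 < poly \<Delta> (U t)) \<longrightarrow> g meromorphic_on {0} \<and>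
      (\<forall>s. 0 < s \<and> s < \<eta> \<longrightarrow> g (of_real s) = of_real (sqrt (poly \<Delta> (U (s\<^sup>2))))))"
  proof (cases "\<forall>t. 0 < t \<and> t < dD \<longrightarrow> 0 < poly \<Delta> (U t)")
    case True
    have "\<exists>g \<delta>. g meromorphic_on {0} \<and> 0 < \<delta> \<and>
        (\<forall>s. 0 < s \<and> s < \<delta> \<longrightarrow> g (of_real s) = of_real (sqrt (poly \<Delta> (U (s\<^sup>2)))))"
    proof (rule real_meromorphic_sqrt[where h = "\<lambda>z. poly (m \<Delta>) (Uc z)" and \<epsilon> = dD])
      show "(\<lambda>z. poly (m \<Delta>) (Uc z)) meromorphic_on {0}" by (rule meromorphic_on_poly[OF Uc])
      show "poly (m \<Delta>) (Uc (of_real t)) = of_real (poly \<Delta> (U t))" if "0 < t" for t by (rule m[OF that])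
      show "0 < poly \<Delta> (U t)" if "0 < t" "t < dD" for t using True that by blast
    qed (rule dD(1))
    then obtain g \<eta> where "g meromorphic_on {0}" "0 < \<eta>"
        "\<forall>s. 0 < s \<and> s < \<eta> \<longrightarrow> g (of_real s) = of_real (sqrt (poly \<Delta> (U (s\<^sup>2))))"
      by (elim exE conjE) (rule that)
    then show ?thesis by (intro exI[of _ g] exI[of _ \<eta>]) simp
  next
    case False
    then show ?thesis by (intro exI[of _ "\<lambda>_. 0"] exI[of _ 1]) (simp only: simp_thms zero_less_one)
  qed
  then obtain g \<eta> where g: "0 < \<eta>" "(\<forall>t. 0 < t \<and> t < dD \<longrightarrow> 0 < poly \<Delta> (U t)) \<longrightarrow> g meromorphic_on {0} \<and>
      (\<forall>s. 0 < s \<and> s < \<eta> \<longrightarrow> g (of_real s) = of_real (sqrt (poly \<Delta> (U (s\<^sup>2)))))"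
    by (elim exE conjE) (rule that)
  define \<epsilon> where "\<epsilon> = min (min 1 \<eta>) (min (min dA dB) (min dC dD))"
  have \<epsilon>: "0 < \<epsilon>" "\<epsilon> \<le> 1" "\<epsilon> \<le> dA" "\<epsilon> \<le> dB" "\<epsilon> \<le> dC" "\<epsilon> \<le> dD" "\<epsilon> \<le> \<eta>"
    using dA(1) dB(1) dC(1) dD(1) g(1) by (auto simp: \<epsilon>_def)
  have sq: "0 < s\<^sup>2" "s\<^sup>2 < \<epsilon>" if "0 < s" "s < \<epsilon>" for s :: real
  proof -
    have "s * s < \<epsilon> * 1" using that \<epsilon> by (intro mult_strict_mono) auto
    then show "s\<^sup>2 < \<epsilon>" by (simp add: power2_eq_square)
    show "0 < s\<^sup>2" using that by simp
  qed
  define u where "u s = U (s\<^sup>2)" for s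
  define uc where "uc z = Uc (z\<^sup>2)" for z
  have uc_real: "uc (of_real s) = of_real (u s)" if "0 < s" "s < \<epsilon>" for s
    using U[OF sq(1)[OF that]] by (simp add: uc_def u_def)
  have uc_mero: "(\<lambda>z. poly (m D) (uc z)) meromorphic_on {0}" for D
    unfolding uc_def by (rule meromorphic_on_poly[OF Uc2])
  have uc_poly: "poly (m D) (uc (of_real s)) = of_real (poly D (u s))" if "0 < s" "s < \<epsilon>" for D s
    unfolding uc_real[OF that] m_def by (rule poly_map_poly_of_real)
  have u_inj: "inj_on u {0<..<\<epsilon>}"
  proof (rule inj_onI)
    fix s t assume st: "s \<in> {0<..<\<epsilon>}" "t \<in> {0<..<\<epsilon>}" "u s = u t"
    then have "s\<^sup>2 = t\<^sup>2" using inj sq(1)[of s] sq(1)[of t] by (auto simp: u_def inj_on_eq_iff)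
    then show "s = t" using st(1,2) by (simp add: power2_eq_iff_nonneg)
  qed
  let ?eq = "\<lambda>s v. poly A (u s) * v\<^sup>2 + poly B (u s) * v + poly C (u s) = 0"
  let ?graph = "\<lambda>v s1. (\<lambda>s. stereo e w p (u s) (v s)) ` {0<..<s1}"
  have graph: "\<exists>\<delta>>0. \<delta> \<le> \<epsilon> \<and> (\<forall>s1. 0 < s1 \<and> s1 < \<delta> \<longrightarrow> covered V (?graph v s1))"
    if "vc meromorphic_on {0}" "\<And>s. 0 < s \<Longrightarrow> s < \<epsilon> \<Longrightarrow> vc (of_real s) = of_real (v s)"
      "\<And>s. 0 < s \<Longrightarrow> s < \<epsilon> \<Longrightarrow> ?eq s (v s)" for vc v
  proof (rule stereo_arc_covered[OF fr _ that(1) \<epsilon>(1) uc_real that(2) u_inj V(1,2)])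
    have "uc = (\<lambda>z. Uc (z\<^sup>2))" by (rule ext) (simp add: uc_def)
    then show "uc meromorphic_on {0}" using Uc2 by simp
    show "stereo e w p (u s) (v s) \<in> V" if "0 < s" "s < \<epsilon>" for s
      using mem \<open>\<And>s. 0 < s \<Longrightarrow> s < \<epsilon> \<Longrightarrow> ?eq s (v s)\<close>[OF that] by simp
  qed
  have over_eq: "over ((\<lambda>s. U (s\<^sup>2)) ` {0<..<s1}) = (\<Union>s\<in>{0<..<s1}. stereo e w p (u s) ` {v. ?eq s v})" for s1
  proof (intro equalityI subsetI)
    fix x assume "x \<in> over ((\<lambda>s. U (s\<^sup>2)) ` {0<..<s1})"
    then obtain a v where "x = stereo e w p a v" "a \<in> (\<lambda>s. U (s\<^sup>2)) ` {0<..<s1}" "x \<in> V"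
      unfolding over_def by blast
    moreover then obtain s where "s \<in> {0<..<s1}" "a = u s" unfolding u_def by blast
    ultimately show "x \<in> (\<Union>s\<in>{0<..<s1}. stereo e w p (u s) ` {v. ?eq s v})"
      using mem by (intro UN_I[of s]) auto
  next
    fix x assume "x \<in> (\<Union>s\<in>{0<..<s1}. stereo e w p (u s) ` {v. ?eq s v})"
    then obtain s v where s: "s \<in> {0<..<s1}" "x = stereo e w p (u s) v" "?eq s v" by blast
    then have "x \<in> V" using mem by simp
    moreover have "u s \<in> (\<lambda>s. U (s\<^sup>2)) ` {0<..<s1}" using s(1) unfolding u_def by (rule imageI)
    ultimately show "x \<in> over ((\<lambda>s. U (s\<^sup>2)) ` {0<..<s1})" using s(2) unfolding over_def by blast
  qed
  have no_point: ?thesis if "\<And>s v. 0 < s \<Longrightarrow> s < \<epsilon> \<Longrightarrow> \<not> ?eq s v"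
  proof (intro exI[of _ \<epsilon>] conjI allI impI \<epsilon>(1))
    fix s1 assume s1: "0 < s1 \<and> s1 < \<epsilon>"
    have "{v. ?eq s v} = {}" if "s \<in> {0<..<s1}" for s
      using \<open>\<And>s v. 0 < s \<Longrightarrow> s < \<epsilon> \<Longrightarrow> \<not> ?eq s v\<close>[of s] that s1 by simp
    then have "over ((\<lambda>s. U (s\<^sup>2)) ` {0<..<s1}) = {}" unfolding over_eq by simp
    then show "covered V (over ((\<lambda>s. U (s\<^sup>2)) ` {0<..<s1}))" by (simp add: covered_finite)
  qed
  have one_point: ?thesis
    if v: "vc meromorphic_on {0}" "\<And>s. 0 < s \<Longrightarrow> s < \<epsilon> \<Longrightarrow> vc (of_real s) = of_real (v s)"
      and eq: "\<And>s v'. 0 < s \<Longrightarrow> s < \<epsilon> \<Longrightarrow> ?eq s v' \<longleftrightarrow> v' = v s" for vc v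
  proof -
    have "?eq s (v s)" if "0 < s" "s < \<epsilon>" for s using eq[OF that] by simp
    then obtain \<delta> where \<delta>: "\<delta> > 0" "\<delta> \<le> \<epsilon>" "\<forall>s1. 0 < s1 \<and> s1 < \<delta> \<longrightarrow> covered V (?graph v s1)"
      using graph[OF v] by blast
    show ?thesis
    proof (intro exI[of _ \<delta>] conjI allI impI \<delta>(1))
      fix s1 assume s1: "0 < s1 \<and> s1 < \<delta>"
      have "{v'. ?eq s v'} = {v s}" if "s \<in> {0<..<s1}" for s
        using eq[of s] that s1 \<delta>(2) by simp
      then have "over ((\<lambda>s. U (s\<^sup>2)) ` {0<..<s1}) = ?graph v s1" unfolding over_eq by auto
      then show "covered V (over ((\<lambda>s. U (s\<^sup>2)) ` {0<..<s1}))" using \<delta>(3) s1 by simp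
    qed
  qed
  have two_points: ?thesis
    if va: "vca meromorphic_on {0}" "\<And>s. 0 < s \<Longrightarrow> s < \<epsilon> \<Longrightarrow> vca (of_real s) = of_real (va s)"
      and vb: "vcb meromorphic_on {0}" "\<And>s. 0 < s \<Longrightarrow> s < \<epsilon> \<Longrightarrow> vcb (of_real s) = of_real (vb s)"
      and eq: "\<And>s v'. 0 < s \<Longrightarrow> s < \<epsilon> \<Longrightarrow> ?eq s v' \<longleftrightarrow> v' = va s \<or> v' = vb s"
      and ne: "\<And>s. 0 < s \<Longrightarrow> s < \<epsilon> \<Longrightarrow> va s \<noteq> vb s" for vca va vcb vb
  proof -
    have "?eq s (va s)" "?eq s (vb s)" if "0 < s" "s < \<epsilon>" for s
      using eq[OF that, of "va s"] eq[OF that, of "vb s"] by simp_all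
    note sol = this
    obtain d1 where d1: "d1 > 0" "d1 \<le> \<epsilon>" "\<forall>s1. 0 < s1 \<and> s1 < d1 \<longrightarrow> covered V (?graph va s1)"
      using graph[OF va sol(1)] by blast
    obtain d2 where d2: "d2 > 0" "d2 \<le> \<epsilon>" "\<forall>s1. 0 < s1 \<and> s1 < d2 \<longrightarrow> covered V (?graph vb s1)"
      using graph[OF vb sol(2)] by blast
    have "0 < min d1 d2" using d1 d2 by simp
    then show ?thesis
    proof (intro exI[of _ "min d1 d2"] conjI allI impI)
      fix s1 assume s1: "0 < s1 \<and> s1 < min d1 d2"
      have "{v'. ?eq s v'} = {va s, vb s}" if "s \<in> {0<..<s1}" for s
        using eq[of s] that s1 d1(2) by auto
      then have "over ((\<lambda>s. U (s\<^sup>2)) ` {0<..<s1}) = ?graph va s1 \<union> ?graph vb s1" unfolding over_eq by auto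
      moreover have "?graph va s1 \<inter> ?graph vb s1 = {}"
      proof (rule ccontr)
        assume "?graph va s1 \<inter> ?graph vb s1 \<noteq> {}"
        then obtain s t where st: "s \<in> {0<..<s1}" "t \<in> {0<..<s1}"
          "stereo e w p (u s) (va s) = stereo e w p (u t) (vb t)" by blast
        then have *: "u s = u t" "va s = vb t" using stereo_inj[OF fr st(3)] by auto
        have "s \<in> {0<..<\<epsilon>}" "t \<in> {0<..<\<epsilon>}" using st(1,2) s1 d1(2) by auto
        then have "s = t" using *(1) u_inj by (simp add: inj_on_eq_iff)
        then show False using *(2) ne[of s] \<open>s \<in> {0<..<\<epsilon>}\<close> by simp
      qed
      ultimately show "covered V (over ((\<lambda>s. U (s\<^sup>2)) ` {0<..<s1}))"
        using covered_Un d1(3) d2(3) s1 by simp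
    qed
  qed
  have square: "4 * a * (a * v\<^sup>2 + b * v + c) = (2 * a * v + b)\<^sup>2 - (b\<^sup>2 - 4 * a * c)" for a b c v :: real
    by algebra
  show ?thesis
  proof (cases "\<forall>t. 0 < t \<and> t < dA \<longrightarrow> poly A (U t) = 0")
    case False
    have A0: "poly A (u s) \<noteq> 0" if "0 < s" "s < \<epsilon>" for s
      using dA(2) False sq[OF that] \<epsilon>(3) unfolding u_def by simp
    have eq_square: "?eq s v \<longleftrightarrow> (2 * poly A (u s) * v + poly B (u s))\<^sup>2 = poly \<Delta> (u s)"
      if "0 < s" "s < \<epsilon>" for s v
      using square[of "poly A (u s)" v "poly B (u s)" "poly C (u s)"] A0[OF that] unfolding poly_\<Delta> by auto
    from dD(2) show ?thesis
    proof (elim disjE)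
      assume D: "\<forall>t. 0 < t \<and> t < dD \<longrightarrow> poly \<Delta> (U t) < 0"
      show ?thesis
      proof (rule no_point)
        fix s v :: real assume s: "0 < s" "s < \<epsilon>"
        have "poly \<Delta> (u s) < 0" using D sq[OF s] \<epsilon>(6) unfolding u_def by simp
        then show "\<not> ?eq s v" unfolding eq_square[OF s]
          using zero_le_power2[of "2 * poly A (u s) * v + poly B (u s)"] by linarith
      qed
    next
      assume D: "\<forall>t. 0 < t \<and> t < dD \<longrightarrow> poly \<Delta> (U t) = 0"
      show ?thesis
      proof (rule one_point[where v = "\<lambda>s. - poly B (u s) / (2 * poly A (u s))"
            and vc = "\<lambda>z. - poly (m B) (uc z) / (2 * poly (m A) (uc z))"])
        show "(\<lambda>z. - poly (m B) (uc z) / (2 * poly (m A) (uc z))) meromorphic_on {0}"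
          by (intro meromorphic_intros uc_mero)
        fix s v :: real assume s: "0 < s" "s < \<epsilon>"
        show "- poly (m B) (uc (of_real s)) / (2 * poly (m A) (uc (of_real s))) =
            of_real (- poly B (u s) / (2 * poly A (u s)))" by (simp add: uc_poly[OF s])
        have "poly \<Delta> (u s) = 0" using D sq[OF s] \<epsilon>(6) unfolding u_def by simp
        then have "?eq s v \<longleftrightarrow> 2 * poly A (u s) * v + poly B (u s) = 0"
          unfolding eq_square[OF s] by simp
        also have "\<dots> \<longleftrightarrow> v = - poly B (u s) / (2 * poly A (u s))"
          using A0[OF s] by (auto simp: field_simps add_eq_0_iff)
        finally show "?eq s v \<longleftrightarrow> v = - poly B (u s) / (2 * poly A (u s))" .
      qed
    next
      assume D: "\<forall>t. 0 < t \<and> t < dD \<longrightarrow> 0 < poly \<Delta> (U t)"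
      have g_real: "g (of_real s) = of_real (sqrt (poly \<Delta> (u s)))" if "0 < s" "s < \<epsilon>" for s
        using g(2) D that \<epsilon>(7) unfolding u_def by auto
      show ?thesis
      proof (rule two_points[where va = "\<lambda>s. (- poly B (u s) + sqrt (poly \<Delta> (u s))) / (2 * poly A (u s))"
            and vca = "\<lambda>z. (- poly (m B) (uc z) + g z) / (2 * poly (m A) (uc z))"
            and vb = "\<lambda>s. (- poly B (u s) - sqrt (poly \<Delta> (u s))) / (2 * poly A (u s))"
            and vcb = "\<lambda>z. (- poly (m B) (uc z) - g z) / (2 * poly (m A) (uc z))"])
        have gm: "g meromorphic_on {0}" using g(2) D by blast
        show "(\<lambda>z. (- poly (m B) (uc z) + g z) / (2 * poly (m A) (uc z))) meromorphic_on {0}"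
          "(\<lambda>z. (- poly (m B) (uc z) - g z) / (2 * poly (m A) (uc z))) meromorphic_on {0}"
          by (intro meromorphic_intros uc_mero gm)+
        fix s v :: real assume s: "0 < s" "s < \<epsilon>"
        show "(- poly (m B) (uc (of_real s)) + g (of_real s)) / (2 * poly (m A) (uc (of_real s))) =
            of_real ((- poly B (u s) + sqrt (poly \<Delta> (u s))) / (2 * poly A (u s)))"
          "(- poly (m B) (uc (of_real s)) - g (of_real s)) / (2 * poly (m A) (uc (of_real s))) =
            of_real ((- poly B (u s) - sqrt (poly \<Delta> (u s))) / (2 * poly A (u s)))"
          by (simp_all add: uc_poly[OF s] g_real[OF s])
        have pos: "0 < poly \<Delta> (u s)" using D sq[OF s] \<epsilon>(6) unfolding u_def by simp
        define r where "r = sqrt (poly \<Delta> (u s))"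
        have r: "0 < r" "poly \<Delta> (u s) = r\<^sup>2" using pos by (simp_all add: r_def)
        have "?eq s v \<longleftrightarrow> 2 * poly A (u s) * v + poly B (u s) = r \<or> 2 * poly A (u s) * v + poly B (u s) = - r"
          unfolding eq_square[OF s] r(2) by (rule power2_eq_iff)
        also have "\<dots> \<longleftrightarrow> v = (- poly B (u s) + r) / (2 * poly A (u s)) \<or>
            v = (- poly B (u s) - r) / (2 * poly A (u s))"
          using A0[OF s] by (auto simp: field_simps)
        finally show "?eq s v \<longleftrightarrow> v = (- poly B (u s) + sqrt (poly \<Delta> (u s))) / (2 * poly A (u s)) \<or>
            v = (- poly B (u s) - sqrt (poly \<Delta> (u s))) / (2 * poly A (u s))" unfolding r_def .
        show "(- poly B (u s) + sqrt (poly \<Delta> (u s))) / (2 * poly A (u s)) \<noteq>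
            (- poly B (u s) - sqrt (poly \<Delta> (u s))) / (2 * poly A (u s))"
          unfolding r_def[symmetric] using r(1) A0[OF s] by (simp add: field_simps)
      qed
    qed
  next
    case True
    have A0: "poly A (u s) = 0" if "0 < s" "s < \<epsilon>" for s
      using True sq[OF that] \<epsilon>(3) unfolding u_def by simp
    show ?thesis
    proof (cases "\<forall>t. 0 < t \<and> t < dB \<longrightarrow> poly B (U t) = 0")
      case False
      have B0: "poly B (u s) \<noteq> 0" if "0 < s" "s < \<epsilon>" for s
        using dB(2) False sq[OF that] \<epsilon>(4) unfolding u_def by simp
      show ?thesis
      proof (rule one_point[where v = "\<lambda>s. - poly C (u s) / poly B (u s)"
            and vc = "\<lambda>z. - poly (m C) (uc z) / poly (m B) (uc z)"])
        show "(\<lambda>z. - poly (m C) (uc z) / poly (m B) (uc z)) meromorphic_on {0}"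
          by (intro meromorphic_intros uc_mero)
        fix s v :: real assume s: "0 < s" "s < \<epsilon>"
        show "- poly (m C) (uc (of_real s)) / poly (m B) (uc (of_real s)) =
            of_real (- poly C (u s) / poly B (u s))" by (simp add: uc_poly[OF s])
        show "?eq s v \<longleftrightarrow> v = - poly C (u s) / poly B (u s)"
          unfolding A0[OF s] using B0[OF s] by (auto simp: field_simps add_eq_0_iff)
      qed
    next
      case B0: True
      have C_not: "\<not> (\<forall>t. 0 < t \<and> t < dC \<longrightarrow> poly C (U t) = 0)"
      proof
        assume C0: "\<forall>t. 0 < t \<and> t < dC \<longrightarrow> poly C (U t) = 0"
        \<comment> \<open>a polynomial that vanishes on the infinite set of values of \<open>U\<close> is zero\<close>
        have zero: "D = 0" if "\<forall>t. 0 < t \<and> t < d \<longrightarrow> poly D (U t) = 0" "d \<ge> \<epsilon>" for D d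
        proof (rule ccontr)
          assume "D \<noteq> 0"
          then have "finite {x. poly D x = 0}" by (rule poly_roots_finite)
          moreover have "U ` {0<..<\<epsilon>} \<subseteq> {x. poly D x = 0}" using that by auto
          ultimately have "finite (U ` {0<..<\<epsilon>})" by (rule finite_subset[rotated])
          moreover have "inj_on U {0<..<\<epsilon>}" by (rule inj_on_subset[OF inj]) auto
          ultimately have "finite {0<..<\<epsilon>}" by (simp add: finite_image_iff)
          then show False using infinite_Ioo[OF \<epsilon>(1)] by blast
        qed
        show False using zero[OF True \<epsilon>(3)] zero[OF B0 \<epsilon>(4)] zero[OF C0 \<epsilon>(5)] nonzero by simp
      qed
      have C_nz: "\<forall>t. 0 < t \<and> t < dC \<longrightarrow> poly C (U t) \<noteq> 0"
        using dC(2) C_not by blast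
      have C0: "poly C (u s) \<noteq> 0" if "0 < s" "s < \<epsilon>" for s
        using C_nz sq[OF that] \<epsilon>(5) unfolding u_def by simp
      show ?thesis
      proof (rule no_point)
        fix s v :: real assume s: "0 < s" "s < \<epsilon>"
        have "poly B (u s) = 0" using B0 sq[OF s] \<epsilon>(4) unfolding u_def by simp
        then show "\<not> ?eq s v" using A0[OF s] C0[OF s] by simp
      qed
    qed
  qed
qed

end

context stereo_curve
begin

lemma covered_right:
  "\<exists>\<delta>>0. \<forall>b. a < b \<and> b < a + \<delta> \<longrightarrow> covered V (over {a<..<b})"
proof -
  have "\<exists>\<delta>>0. \<forall>s1. 0 < s1 \<and> s1 < \<delta> \<longrightarrow> covered V (over ((\<lambda>s. a + s\<^sup>2) ` {0<..<s1}))"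
    by (rule side_covered[of "\<lambda>z. of_real a + z" "\<lambda>t. a + t"])
      (intro meromorphic_intros, intro meromorphic_intros, simp, simp add: inj_on_def)
  then obtain \<delta> where \<delta>: "\<delta> > 0"
      "\<forall>s1. 0 < s1 \<and> s1 < \<delta> \<longrightarrow> covered V (over ((\<lambda>s. a + s\<^sup>2) ` {0<..<s1}))" by blast
  show ?thesis
  proof (intro exI[of _ "\<delta>\<^sup>2"] conjI allI impI)
    show "0 < \<delta>\<^sup>2" using \<delta>(1) by simp
    fix b assume b: "a < b \<and> b < a + \<delta>\<^sup>2"
    define s1 where "s1 = sqrt (b - a)"
    have s1: "0 < s1" "s1\<^sup>2 = b - a" using b by (simp_all add: s1_def)
    have "s1 < \<delta>" unfolding s1_def using b \<delta>(1) by (intro real_less_lsqrt) auto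
    moreover have "(\<lambda>s. a + s\<^sup>2) ` {0<..<s1} = {a<..<b}"
    proof (intro equalityI subsetI)
      fix x assume "x \<in> (\<lambda>s. a + s\<^sup>2) ` {0<..<s1}"
      then obtain s where s: "0 < s" "s < s1" "x = a + s\<^sup>2" by auto
      then have "s\<^sup>2 < s1\<^sup>2" by (intro power_strict_mono) auto
      then show "x \<in> {a<..<b}" using s s1(2) by auto
    next
      fix x assume x: "x \<in> {a<..<b}"
      then have "sqrt (x - a) < s1" unfolding s1_def by simp
      then show "x \<in> (\<lambda>s. a + s\<^sup>2) ` {0<..<s1}"
        using x by (intro image_eqI[of _ _ "sqrt (x - a)"]) auto
    qed
    ultimately show "covered V (over {a<..<b})" using \<delta>(2) s1(1) by metis
  qed
qed

lemma covered_left: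
  "\<exists>\<delta>>0. \<forall>b. b < a \<and> a - \<delta> < b \<longrightarrow> covered V (over {b<..<a})"
proof -
  have "\<exists>\<delta>>0. \<forall>s1. 0 < s1 \<and> s1 < \<delta> \<longrightarrow> covered V (over ((\<lambda>s. a - s\<^sup>2) ` {0<..<s1}))"
    by (rule side_covered[of "\<lambda>z. of_real a - z" "\<lambda>t. a - t"])
      (intro meromorphic_intros, intro meromorphic_intros, simp, simp add: inj_on_def)
  then obtain \<delta> where \<delta>: "\<delta> > 0"
      "\<forall>s1. 0 < s1 \<and> s1 < \<delta> \<longrightarrow> covered V (over ((\<lambda>s. a - s\<^sup>2) ` {0<..<s1}))" by blast
  show ?thesis
  proof (intro exI[of _ "\<delta>\<^sup>2"] conjI allI impI)
    show "0 < \<delta>\<^sup>2" using \<delta>(1) by simp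
    fix b assume b: "b < a \<and> a - \<delta>\<^sup>2 < b"
    define s1 where "s1 = sqrt (a - b)"
    have s1: "0 < s1" "s1\<^sup>2 = a - b" using b by (simp_all add: s1_def)
    have "s1 < \<delta>" unfolding s1_def using b \<delta>(1) by (intro real_less_lsqrt) auto
    moreover have "(\<lambda>s. a - s\<^sup>2) ` {0<..<s1} = {b<..<a}"
    proof (intro equalityI subsetI)
      fix x assume "x \<in> (\<lambda>s. a - s\<^sup>2) ` {0<..<s1}"
      then obtain s where s: "0 < s" "s < s1" "x = a - s\<^sup>2" by auto
      then have "s\<^sup>2 < s1\<^sup>2" by (intro power_strict_mono) auto
      then show "x \<in> {b<..<a}" using s s1(2) by auto
    next
      fix x assume x: "x \<in> {b<..<a}"
      then have "sqrt (a - x) < s1" unfolding s1_def by simp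
      then show "x \<in> (\<lambda>s. a - s\<^sup>2) ` {0<..<s1}"
        using x by (intro image_eqI[of _ _ "sqrt (a - x)"]) auto
    qed
    ultimately show "covered V (over {b<..<a})" using \<delta>(2) s1(1) by metis
  qed
qed

lemma covered_above: "\<exists>R>0. covered V (over {R<..})"
proof -
  have "\<exists>\<delta>>0. \<forall>s1. 0 < s1 \<and> s1 < \<delta> \<longrightarrow> covered V (over ((\<lambda>s. 1 / s\<^sup>2) ` {0<..<s1}))"
    by (rule side_covered[of "\<lambda>z. 1 / z" "\<lambda>t. 1 / t"])
      (intro meromorphic_intros, intro meromorphic_intros, simp, simp add: inj_on_def)
  then obtain \<delta> where \<delta>: "\<delta> > 0"
      "\<forall>s1. 0 < s1 \<and> s1 < \<delta> \<longrightarrow> covered V (over ((\<lambda>s. 1 / s\<^sup>2) ` {0<..<s1}))" by blast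
  define s1 where "s1 = \<delta> / 2"
  have s1: "0 < s1" "s1 < \<delta>" using \<delta>(1) by (simp_all add: s1_def)
  have "(\<lambda>s. 1 / s\<^sup>2) ` {0<..<s1} = {1 / s1\<^sup>2<..}"
  proof (intro equalityI subsetI)
    fix x assume "x \<in> (\<lambda>s. 1 / s\<^sup>2) ` {0<..<s1}"
    then obtain s where s: "0 < s" "s < s1" "x = 1 / s\<^sup>2" by auto
    then have "s\<^sup>2 < s1\<^sup>2" by (intro power_strict_mono) auto
    then show "x \<in> {1 / s1\<^sup>2<..}" using s by (auto intro!: divide_strict_left_mono)
  next
    fix x assume "x \<in> {1 / s1\<^sup>2<..}"
    then have x: "1 / s1\<^sup>2 < x" by simp
    have "0 < 1 / s1\<^sup>2" using s1(1) by simp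
    then have x0: "0 < x" using x by linarith
    have "1 / x < s1\<^sup>2" using x x0 s1(1) by (simp add: field_simps)
    then have "sqrt (1 / x) < s1" using s1(1) x0 by (intro real_less_lsqrt) auto
    then show "x \<in> (\<lambda>s. 1 / s\<^sup>2) ` {0<..<s1}"
      using x0 by (intro image_eqI[of _ _ "sqrt (1 / x)"]) auto
  qed
  then have "covered V (over {1 / s1\<^sup>2<..})" using \<delta>(2) s1 by metis
  then show ?thesis using s1(1) by (intro exI[of _ "1 / s1\<^sup>2"]) simp
qed

lemma covered_below: "\<exists>R>0. covered V (over {..<- R})"
proof -
  have "\<exists>\<delta>>0. \<forall>s1. 0 < s1 \<and> s1 < \<delta> \<longrightarrow> covered V (over ((\<lambda>s. - 1 / s\<^sup>2) ` {0<..<s1}))"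
    by (rule side_covered[of "\<lambda>z. - 1 / z" "\<lambda>t. - 1 / t"])
      (intro meromorphic_intros, intro meromorphic_intros, simp, simp add: inj_on_def)
  then obtain \<delta> where \<delta>: "\<delta> > 0"
      "\<forall>s1. 0 < s1 \<and> s1 < \<delta> \<longrightarrow> covered V (over ((\<lambda>s. - 1 / s\<^sup>2) ` {0<..<s1}))" by blast
  define s1 where "s1 = \<delta> / 2"
  have s1: "0 < s1" "s1 < \<delta>" using \<delta>(1) by (simp_all add: s1_def)
  have "(\<lambda>s. - 1 / s\<^sup>2) ` {0<..<s1} = {..<- (1 / s1\<^sup>2)}"
  proof (intro equalityI subsetI)
    fix x assume "x \<in> (\<lambda>s. - 1 / s\<^sup>2) ` {0<..<s1}"
    then obtain s where s: "0 < s" "s < s1" "x = - (1 / s\<^sup>2)" by auto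
    then have "s\<^sup>2 < s1\<^sup>2" by (intro power_strict_mono) auto
    then have "1 / s1\<^sup>2 < 1 / s\<^sup>2" using s(1) s1(1) by (intro divide_strict_left_mono) auto
    then show "x \<in> {..<- (1 / s1\<^sup>2)}" using s(3) by simp
  next
    fix x assume "x \<in> {..<- (1 / s1\<^sup>2)}"
    then have x: "1 / s1\<^sup>2 < - x" by simp
    have "0 < 1 / s1\<^sup>2" using s1(1) by simp
    then have x0: "0 < - x" using x by linarith
    have "1 / (- x) < s1\<^sup>2" using x x0 s1(1) by (simp add: field_simps)
    then have "sqrt (1 / (- x)) < s1" using s1(1) x0 by (intro real_less_lsqrt) auto
    then show "x \<in> (\<lambda>s. - 1 / s\<^sup>2) ` {0<..<s1}"
      using x0 by (intro image_eqI[of _ _ "sqrt (1 / (- x))"]) auto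
  qed
  then have "covered V (over {..<- (1 / s1\<^sup>2)})" using \<delta>(2) s1 by metis
  then show ?thesis using s1(1) by (intro exI[of _ "1 / s1\<^sup>2"]) simp
qed

text \<open>Bolzano's bisection principle turns the one-sided local statements into one for compact intervals. Half-open
  intervals are used because adjacent ones are disjoint.\<close>

lemma covered_interval:
  assumes "a \<le> b"
  shows "covered V (over {a<..b})"
  using assms
proof (induction a b rule: Bolzano)
  case (trans a b c)
  have "{a<..b} \<union> {b<..c} = {a<..c}" "{a<..b} \<inter> {b<..c} = {}" using trans(3,4) by auto
  then show ?case using covered_over_Un[OF trans(1,2)] by simp
next
  case (local x)
  obtain d1 where d1: "d1 > 0" "\<forall>b. x < b \<and> b < x + d1 \<longrightarrow> covered V (over {x<..<b})"
    using covered_right[of x] by blast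
  obtain d2 where d2: "d2 > 0" "\<forall>b. b < x \<and> x - d2 < b \<longrightarrow> covered V (over {b<..<x})"
    using covered_left[of x] by blast
  have "covered V (over {a<..b})" if ab: "a \<le> x" "x \<le> b" "b - a < min d1 d2" for a b
  proof -
    have "covered V (over {a<..x})"
    proof (cases "a = x")
      case True
      then show ?thesis using covered_over_empty by simp
    next
      case False
      then have "covered V (over {a<..<x})" using d2(2) ab by simp
      moreover have "{a<..x} = {a<..<x} \<union> {x}" using ab(1) False by auto
      ultimately show ?thesis using covered_over_Un[OF _ covered_over_point] by simp
    qed
    moreover have "covered V (over {x<..b})"
    proof (cases "b = x")
      case True
      then show ?thesis using covered_over_empty by simp
    next
      case False
      then have "covered V (over {x<..<b})" using d1(2) ab by simp
      moreover have "{x<..b} = {x<..<b} \<union> {b}" using ab(2) False by auto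
      ultimately show ?thesis using covered_over_Un[OF _ covered_over_point] by simp
    qed
    moreover have "{a<..x} \<union> {x<..b} = {a<..b}" "{a<..x} \<inter> {x<..b} = {}" using ab by auto
    ultimately show ?thesis using covered_over_Un[of "{a<..x}" "{x<..b}"] by simp
  qed
  then show ?case using d1(1) d2(1) by (intro exI[of _ "min d1 d2"]) simp
qed

lemma covered_curve: "covered V V"
proof -
  obtain R where R: "R > 0" "covered V (over {R<..})" using covered_above by blast
  obtain R' where R': "R' > 0" "covered V (over {..<- R'})" using covered_below by blast
  have "covered V (over ({..<- R'} \<union> {- R'}))"
    by (rule covered_over_Un[OF R'(2) covered_over_point]) simp
  moreover have "covered V (over {- R'<..R})" using R(1) R'(1) by (intro covered_interval) simp
  ultimately have "covered V (over ({..<- R'} \<union> {- R'} \<union> {- R'<..R}))"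
    by (rule covered_over_Un) auto
  then have "covered V (over ({..<- R'} \<union> {- R'} \<union> {- R'<..R} \<union> {R<..}))"
    by (rule covered_over_Un[OF _ R(2)]) (use R(1) R'(1) in auto)
  moreover have "{..<- R'} \<union> {- R'} \<union> {- R'<..R} \<union> {R<..} = UNIV" using R(1) R'(1) by auto
  ultimately have "covered V (over UNIV)" by simp
  moreover have "covered V {p}" using V(3) by (intro covered_finite) auto
  moreover have "over UNIV \<inter> {p} = {}"
  proof -
    have "stereo e w p u v \<noteq> p" for u v
    proof
      assume "stereo e w p u v = p"
      then have "1 - 2 / (1 + u\<^sup>2 + v\<^sup>2) = 1"
        using stereo_coords(3)[OF fr, of u v] fr unfolding frame_def by simp
      then show False using stereo_denom[of u v] by simp
    qed
    note ne = this
    have "p \<notin> over UNIV"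
    proof
      assume "p \<in> over UNIV"
      then obtain u v where "p = stereo e w p u v" unfolding over_def by blast
      then show False using ne[of u v] by simp
    qed
    then show ?thesis by simp
  qed
  ultimately have "covered V (over UNIV \<union> {p})" by (rule covered_Un)
  moreover have "over UNIV \<union> {p} = V"
  proof (intro equalityI subsetI)
    fix x assume x: "x \<in> V"
    show "x \<in> over UNIV \<union> {p}"
    proof (cases "x = p")
      case False
      obtain u v where "x = stereo e w p u v"
        using stereo_surj[OF fr _ False] x V(2) by blast
      then show ?thesis using x unfolding over_def by blast
    qed simp
  qed (use V(3) in \<open>auto simp: over_def\<close>)
  ultimately show ?thesis by simp
qed

end

section \<open>Spherical quadrics as plane curves\<close>

lemma quad_add:
  "quad b A (x + c *\<^sub>R d) = quad b A x + c * (b \<bullet> d + x \<bullet> (A *v d) + d \<bullet> (A *v x)) + c\<^sup>2 * (d \<bullet> (A *v d))"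
  unfolding quad_def
  by (simp add: matrix_vector_right_distrib matrix_vector_mult_scaleR inner_add_left inner_add_right
      power2_eq_square algebra_simps)

text \<open>In the coordinates \<open>x = p + 2 d / D\<close> with \<open>d = u e + v w - p\<close> and \<open>D = 1 + u\<^sup>2 + v\<^sup>2\<close>, a quadratic function
  that vanishes at \<open>p\<close> equals \<open>(2 / D\<^sup>2) (D (g \<cdot> d) + 2 d \<cdot> A d)\<close>, where \<open>g\<close> is its gradient at \<open>p\<close>. Choosing \<open>w\<close>
  orthogonal to \<open>g\<close> makes this of degree two in \<open>v\<close>. The coefficients do not all vanish: a quadratic function
  that is zero on the sphere has \<open>A\<close> with zero diagonal, as its values at opposite unit vectors show.\<close>

lemma covered_quadric:
  assumes "trace A \<noteq> 0"
  shows "covered {x \<in> S2. quad b A x = 0} {x \<in> S2. quad b A x = 0}"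
proof (cases "{x \<in> S2. quad b A x = 0} = {}")
  case True
  show ?thesis unfolding True by (rule covered_finite) auto
next
  case False
  define V where "V = {x \<in> S2. quad b A x = 0}"
  obtain p where p: "p \<in> S2" "quad b A p = 0" using False by blast
  have pp: "p \<bullet> p = 1" using p(1) by (simp add: norm_eq_1)
  define \<beta> where "\<beta> x y = x \<bullet> (A *v y)" for x y
  define G where "G y = b \<bullet> y + \<beta> p y + \<beta> y p" for y
  define g where "g = b + p v* A + A *v p"
  have G_inner: "G y = g \<bullet> y" for y
    unfolding G_def g_def \<beta>_def
    by (simp add: inner_add_left dot_lmul_matrix inner_commute[of y])
  obtain e w where fr: "frame e w p" and wg: "w \<bullet> g = 0" using exists_frame[OF pp] by blast
  have Gw: "G w = 0" using wg by (simp add: G_inner inner_commute)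
  \<comment> \<open>the coefficients of \<open>v\<^sup>2\<close>, \<open>v\<close> and \<open>1\<close> in \<open>D (g \<cdot> d) + 2 d \<cdot> A d\<close>\<close>
  define pA where "pA = [:2 * \<beta> w w - G p, G e:]"
  define pB where "pB = [:- 2 * (\<beta> w p + \<beta> p w), 2 * (\<beta> e w + \<beta> w e):]"
  define pC where "pC = [:2 * \<beta> p p - G p, G e - 2 * (\<beta> e p + \<beta> p e), 2 * \<beta> e e - G p, G e:]"
  have \<beta>_expand: "\<beta> (u *\<^sub>R e + v *\<^sub>R w - p) (u *\<^sub>R e + v *\<^sub>R w - p) =
      u\<^sup>2 * \<beta> e e + u * v * (\<beta> e w + \<beta> w e) + v\<^sup>2 * \<beta> w w - u * (\<beta> e p + \<beta> p e)
      - v * (\<beta> w p + \<beta> p w) + \<beta> p p" for u v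
    unfolding \<beta>_def
    by (simp add: matrix_vector_right_distrib matrix_vector_mult_diff_distrib matrix_vector_mult_scaleR
        inner_add_left inner_add_right inner_diff_left inner_diff_right power2_eq_square algebra_simps)
  have G_expand: "G (u *\<^sub>R e + v *\<^sub>R w - p) = u * G e - G p" for u v
    using Gw unfolding G_inner by (simp add: inner_add_right inner_diff_right)
  have quad_stereo: "quad b A (stereo e w p u v) =
      2 / (1 + u\<^sup>2 + v\<^sup>2)\<^sup>2 * (poly pA u * v\<^sup>2 + poly pB u * v + poly pC u)" for u v
  proof -
    define D where "D = 1 + u\<^sup>2 + v\<^sup>2"
    have D: "D \<noteq> 0" using stereo_denom[of u v] by (simp add: D_def)
    let ?d = "u *\<^sub>R e + v *\<^sub>R w - p"
    have "quad b A (stereo e w p u v) = (2 / D) * G ?d + (2 / D)\<^sup>2 * \<beta> ?d ?d"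
      unfolding stereo_def quad_add p(2) D_def[symmetric] G_def \<beta>_def by simp
    also have "\<dots> = 2 / D\<^sup>2 * (D * G ?d + 2 * \<beta> ?d ?d)"
      using D by (simp add: power2_eq_square field_simps)
    also have "D * G ?d + 2 * \<beta> ?d ?d = poly pA u * v\<^sup>2 + poly pB u * v + poly pC u"
      unfolding G_expand \<beta>_expand D_def pA_def pB_def pC_def
      by (simp add: power2_eq_square algebra_simps)
    finally show ?thesis unfolding D_def .
  qed
  have "stereo_curve e w p V pA pB pC"
  proof
    show "frame e w p" by (rule fr)
    have "continuous_on UNIV (quad b A)"
      unfolding quad_def[abs_def] by (intro continuous_intros matrix_vector_mult_linear_continuous_on)
    then have "closed {x. quad b A x = 0}"
      by (intro closed_Collect_eq) (auto intro: continuous_intros)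
    moreover have "V = S2 \<inter> {x. quad b A x = 0}" unfolding V_def by blast
    ultimately show "closed V" by (simp add: closed_Int)
    show "V \<subseteq> S2" "p \<in> V" using p unfolding V_def by auto
    show mem: "stereo e w p u v \<in> V \<longleftrightarrow> poly pA u * v\<^sup>2 + poly pB u * v + poly pC u = 0" for u v
    proof -
      have "2 / (1 + u\<^sup>2 + v\<^sup>2)\<^sup>2 \<noteq> 0" using stereo_denom[of u v] by simp
      then have "quad b A (stereo e w p u v) = 0 \<longleftrightarrow> poly pA u * v\<^sup>2 + poly pB u * v + poly pC u = 0"
        unfolding quad_stereo mult_eq_0_iff by blast
      then show ?thesis using stereo_in_S2[OF fr] unfolding V_def by blast
    qed
    show "\<not> (pA = 0 \<and> pB = 0 \<and> pC = 0)"
    proof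
      assume "pA = 0 \<and> pB = 0 \<and> pC = 0"
      then have all: "quad b A x = 0" if x_S2: "x \<in> S2" for x
      proof (cases "x = p")
        case False
        obtain u v where x: "x = stereo e w p u v" using stereo_surj[OF fr x_S2 False] by blast
        then have "x \<in> V" using mem[of u v] \<open>pA = 0 \<and> pB = 0 \<and> pC = 0\<close> by simp
        then show ?thesis unfolding V_def by simp
      qed (use p in simp)
      have "A $ i $ i = 0" for i
      proof -
        have "quad b A (axis i 1) = 0" by (rule all) simp
        moreover have "quad b A ((- 1) *\<^sub>R axis i 1) = 0" by (rule all) simp
        ultimately have "axis i 1 \<bullet> (A *v axis i 1) = 0"
          unfolding quad_def matrix_vector_mult_scaleR by simp
        then show ?thesis by (simp add: inner_axis matrix_vector_mult_basis column_def inner_axis')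
      qed
      then show False using assms by (simp add: trace_def)
    qed
  qed
  then have "covered V V" by (rule stereo_curve.covered_curve)
  then show ?thesis unfolding V_def .
qed

section \<open>The support of a minimizing measure\<close>

theorem theorem1p1:
  fixes \<tau> :: real and \<rho> :: "(real ^ 3) measure"
  assumes "\<tau> > sqrt 3" and "minimizing_measure \<tau> \<rho>"
  shows "\<exists>\<C>. finite \<C> \<and> (\<forall>C \<in> \<C>. real_analytic_curve_in S2 C) \<and>
           pairwise (\<lambda>C C'. finite (C \<inter> C')) \<C> \<and>
           measure_support \<rho> \<subseteq> \<Union>\<C>"
proof -
  obtain Q where Q: "finite Q" "\<forall>(b, A) \<in> Q. trace A \<noteq> 0"
      "measure_support \<rho> \<subseteq> (\<Union>(b, A) \<in> Q. {x \<in> S2. quad b A x = 0})"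
    using support_in_finitely_many_quadrics[OF assms] by (elim exE conjE) (rule that)
  have "\<exists>Z. curvilinear Z \<and> (\<Union>(b, A) \<in> Q. {x \<in> S2. quad b A x = 0}) \<subseteq> Z"
  proof (rule curvilinear_cover_quadrics[OF Q(1)])
    fix b A assume "(b, A) \<in> Q"
    then have "trace A \<noteq> 0" using Q(2) by auto
    from covered_quadric[OF this, of b] obtain F E where
      "arc_family F" "finite E" "E \<subseteq> {x \<in> S2. quad b A x = 0}"
      "\<Union>F \<subseteq> {x \<in> S2. quad b A x = 0} \<union> E" "{x \<in> S2. quad b A x = 0} \<subseteq> \<Union>F \<union> E"
      unfolding covered_def by (elim exE conjE) (rule that)
    then show "\<exists>F E. arc_family F \<and> finite E \<and> E \<subseteq> S2 \<and>
       \<Union>F \<subseteq> {x \<in> S2. quad b A x = 0} \<and> {x \<in> S2. quad b A x = 0} \<subseteq> \<Union>F \<union> E"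
      by (intro exI[of _ F] exI[of _ E] conjI) auto
  qed
  then obtain Z where Z: "curvilinear Z" "(\<Union>(b, A) \<in> Q. {x \<in> S2. quad b A x = 0}) \<subseteq> Z"
    by (elim exE conjE) (rule that)
  obtain F where F: "arc_family F" "\<Union>F = Z"
    using Z(1) unfolding curvilinear_def by (elim exE conjE) (rule that)
  show ?thesis
  proof (intro exI[of _ F] conjI ballI)
    show "finite F" "pairwise (\<lambda>C C'. finite (C \<inter> C')) F" using F(1) by (simp_all add: arc_family_def)
    show "real_analytic_curve_in S2 C" if "C \<in> F" for C
    proof -
      have "holo_arc C" "C \<subseteq> S2" using F(1) that unfolding arc_family_def by blast+
      then show ?thesis by (rule holo_arc_imp_real_analytic_curve)
    qed
    show "measure_support \<rho> \<subseteq> \<Union>F" unfolding F(2) by (rule subset_trans[OF Q(3) Z(2)])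
  qed
qed

end
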